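(* Let $\mathcal H$ be a real Hilbert space, let $f:\mathcal H\to\mathbb R\cup\{+\infty\}$ be proper, convex and lower semicontinuous with $\operatorname{argmin}_{\mathcal H} f\neq\emptyset$, and let $\alpha>0$, $\beta>0$, $t_0>0$. Suppose $\delta:[t_0,+\infty)\to(0,+\infty)$ and $\gamma:[t_0,+\infty)\to(0,+\infty)$ are continuously differentiable. Let $(x_0,v_0,y_0)\in\mathcal H^3$ satisfy $$v_0=-\beta\delta(t_0)\nabla f_{\gamma(t_0)}(x_0)-\Big(\frac{\alpha-1}{t_0}-\frac1\beta\Big)x_0-\frac1\beta y_0 .$$ Then, for a function $x:[t_0,+\infty)\to\mathcal H$, the following are equivalent: (i) $x$ is a solution on $[t_0,+\infty)$ of $$\ddot x(t)+\frac{\alpha}{t}\dot x(t)+\beta\,\frac{\mathrm d}{\mathrm dt}\Big[\delta(t)\nabla f_{\gamma(t)}(x(t))\Big]+\Big(1+\frac{\beta}{t}\Big)\delta(t)\nabla f_{\gamma(t)}(x(t))=0$$ with $x(t_0)=x_0$ and $\dot x(t_0)=v_0$. (ii) There exists $y:[t_0,+\infty)\to\mathcal H$ such that $(x,y)$ satisfies on $[t_0,+\infty)$ $$\dot x(t)+\beta\delta(t)\nabla f_{\gamma(t)}(x(t))+\Big(\frac{\alpha-1}{t}-\frac1\beta\Big)x(t)+\frac1\beta y(t)=0,$$ $$\dot y(t)-\Big(\frac1\beta-\frac{\alpha-2}{t}\Big)x(t)+\Big(\frac1t+\frac1\beta\Big)y(t)=0,$$ with $(x(t_0),y(t_0))=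(x_0,y_0)$.
   Context: For $\lambda>0$, $f_\lambda$ denotes the Moreau envelope $f_\lambda(x)=\min_{y\in\mathcal H}\{f(y)+\frac1{2\lambda}\|x-y\|^2\}$; it is convex and $C^1$, with $\frac1\lambda$-Lipschitz gradient $\nabla f_\lambda(x)=\frac1\lambda(x-\operatorname{prox}_{\lambda f}(x))$, where $\operatorname{prox}_{\lambda f}(x)$ is the unique minimizer in the definition of $f_\lambda(x)$. Solution convention: a solution of the second-order equation is a $C^1$ function $x$ with $\dot x$ locally absolutely continuous on $[t_0,+\infty)$, satisfying the equation for almost every $t\ge t_0$. A solution of the first-order system is a pair $(x,y)$ of locally absolutely continuous functions satisfying both equations for almost every $t\ge t_0$. *)

theory Defs
  imports "HOL-Analysis.Analysis"
begin

text \<open>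
  Extended-real-valued functions \<open>f : H \<rightarrow> \<real> \<union> {+\<infinity>}\<close> have type \<open>'a \<Rightarrow> ereal\<close>; the value
  \<open>-\<infinity>\<close> is excluded by \<open>proper_fun\<close>. With \<open>-\<infinity>\<close> excluded, the ereal conventions
  \<open>0 * \<infinity> = 0\<close> and \<open>r + \<infinity> = \<infinity>\<close> make \<open>convex_fun\<close> the usual notion of convexity.
\<close>

definition proper_fun :: "('a \<Rightarrow> ereal) \<Rightarrow> bool" where
  "proper_fun f \<longleftrightarrow> (\<forall>x. f x \<noteq> -\<infinity>) \<and> (\<exists>x. f x \<noteq> \<infinity>)"

definition convex_fun :: "('a::real_vector \<Rightarrow> ereal) \<Rightarrow> bool" where
  "convex_fun f \<longleftrightarrow> (\<forall>x y u v. 0 \<le> u \<and> 0 \<le> v \<and> u + v = 1 \<longrightarrow>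
     f (u *\<^sub>R x + v *\<^sub>R y) \<le> ereal u * f x + ereal v * f y)"

definition lsc_fun :: "('a::topological_space \<Rightarrow> ereal) \<Rightarrow> bool" where
  "lsc_fun f \<longleftrightarrow> (\<forall>x. f x \<le> Liminf (at x) f)"

definition argmin_set :: "('a \<Rightarrow> ereal) \<Rightarrow> 'a set" where
  "argmin_set f = {z. \<forall>y. f z \<le> f y}"

text \<open>
  The infimum is attained, at a unique point, when \<open>f\<close> is proper, convex and lower
  semicontinuous and \<open>\<lambda> > 0\<close>; the envelope is then finite everywhere, so that
  \<open>real_of_ereal\<close> in \<open>moreau_grad\<close> loses nothing.
\<close>

definition moreau_env :: "('a::real_inner \<Rightarrow> ereal) \<Rightarrow> real \<Rightarrow> 'a \<Rightarrow> ereal" where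
  "moreau_env f l x = (INF y. f y + ereal (1 / (2 * l) * (norm (x - y))\<^sup>2))"

definition moreau_grad :: "('a::real_inner \<Rightarrow> ereal) \<Rightarrow> real \<Rightarrow> 'a \<Rightarrow> 'a" where
  "moreau_grad f l x = (THE g. GDERIV (\<lambda>z. real_of_ereal (moreau_env f l z)) x :> g)"

definition abs_cont_on_interval :: "(real \<Rightarrow> 'a::real_normed_vector) \<Rightarrow> real \<Rightarrow> real \<Rightarrow> bool" where
  "abs_cont_on_interval u r s \<longleftrightarrow>
     (\<forall>e>0. \<exists>d>0. \<forall>(n::nat) a b.
        (\<forall>i<n. r \<le> a i \<and> a i \<le> b i \<and> b i \<le> s) \<and>
        disjoint_family_on (\<lambda>i. {a i<..<b i}) {..<n} \<and>
        (\<Sum>i<n. b i - a i) < d \<longrightarrow>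
        (\<Sum>i<n. norm (u (b i) - u (a i))) < e)"

definition loc_abs_cont_from :: "real \<Rightarrow> (real \<Rightarrow> 'a::real_normed_vector) \<Rightarrow> bool" where
  "loc_abs_cont_from t0 u \<longleftrightarrow> (\<forall>r s. t0 \<le> r \<and> r \<le> s \<longrightarrow> abs_cont_on_interval u r s)"

text \<open>
  Functions on \<open>[t0, +\<infinity>)\<close> are total functions on \<open>real\<close> whose values before \<open>t0\<close> are
  irrelevant: all derivatives are taken within \<open>{t0..}\<close>, hence one-sided at \<open>t0\<close>.
\<close>

definition C1_from :: "real \<Rightarrow> (real \<Rightarrow> 'a::real_normed_vector) \<Rightarrow> (real \<Rightarrow> 'a) \<Rightarrow> bool" where
  "C1_from t0 u u' \<longleftrightarrow>
     (\<forall>t\<ge>t0. (u has_vector_derivative u' t) (at t within {t0..})) \<and> continuous_on {t0..} u'"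

text \<open>
  \<open>xd\<close> is the derivative of \<open>x\<close>; at almost every \<open>t\<close>, \<open>xdd\<close> is the derivative of \<open>xd\<close> and
  \<open>gd\<close> that of \<open>s \<mapsto> \<delta> s \<nabla>f\<^bsub>\<gamma> s\<^esub> (x s)\<close>, both of which are required to exist.
\<close>

definition second_order_solution ::
  "('a::real_inner \<Rightarrow> ereal) \<Rightarrow> real \<Rightarrow> real \<Rightarrow> (real \<Rightarrow> real) \<Rightarrow> (real \<Rightarrow> real) \<Rightarrow> real \<Rightarrow>
   'a \<Rightarrow> 'a \<Rightarrow> (real \<Rightarrow> 'a) \<Rightarrow> bool" where
  "second_order_solution f \<alpha> \<beta> \<delta> \<gamma> t0 x0 v0 x \<longleftrightarrow>
     (\<exists>xd. C1_from t0 x xd \<and> loc_abs_cont_from t0 xd \<and>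
        (AE t in lebesgue. t0 \<le> t \<longrightarrow>
           (\<exists>xdd gd.
              (xd has_vector_derivative xdd) (at t within {t0..}) \<and>
              ((\<lambda>s. \<delta> s *\<^sub>R moreau_grad f (\<gamma> s) (x s)) has_vector_derivative gd)
                 (at t within {t0..}) \<and>
              xdd + (\<alpha> / t) *\<^sub>R xd t + \<beta> *\<^sub>R gd
                + ((1 + \<beta> / t) * \<delta> t) *\<^sub>R moreau_grad f (\<gamma> t) (x t) = 0)) \<and>
        x t0 = x0 \<and> xd t0 = v0)"

definition first_order_solution ::
  "('a::real_inner \<Rightarrow> ereal) \<Rightarrow> real \<Rightarrow> real \<Rightarrow> (real \<Rightarrow> real) \<Rightarrow> (real \<Rightarrow> real) \<Rightarrow> real \<Rightarrow>
   'a \<Rightarrow> 'a \<Rightarrow> (real \<Rightarrow> 'a) \<Rightarrow> (real \<Rightarrow> 'a) \<Rightarrow> bool" where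
  "first_order_solution f \<alpha> \<beta> \<delta> \<gamma> t0 x0 y0 x y \<longleftrightarrow>
     loc_abs_cont_from t0 x \<and> loc_abs_cont_from t0 y \<and>
     (AE t in lebesgue. t0 \<le> t \<longrightarrow>
        (\<exists>xd yd.
           (x has_vector_derivative xd) (at t within {t0..}) \<and>
           (y has_vector_derivative yd) (at t within {t0..}) \<and>
           xd + (\<beta> * \<delta> t) *\<^sub>R moreau_grad f (\<gamma> t) (x t)
             + ((\<alpha> - 1) / t - 1 / \<beta>) *\<^sub>R x t + (1 / \<beta>) *\<^sub>R y t = 0 \<and>
           yd - (1 / \<beta> - (\<alpha> - 2) / t) *\<^sub>R x t + (1 / t + 1 / \<beta>) *\<^sub>R y t = 0)) \<and>
     x t0 = x0 \<and> y t0 = y0"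

end

theory Submission
  imports Defs
begin

text \<open>
  Where the first-order equation for \<open>x\<close> holds, \<open>y\<close> is determined by \<open>x\<close>, its derivative and
  \<open>g t = \<delta> t \<nabla>f\<^bsub>\<gamma> t\<^esub> (x t)\<close>; differentiating this relation turns one equation into the other, so
  the theorem is a matter of regularity. Monotonicity of the subgradients gives
  \<open>\<lambda> \<bar>\<nabla>f\<^bsub>\<lambda>\<^esub> x - \<nabla>f\<^bsub>\<mu>\<^esub> x'\<bar> \<le> \<bar>x - x'\<bar> + \<bar>\<lambda> - \<mu>\<bar> \<bar>\<nabla>f\<^bsub>\<mu>\<^esub> x'\<bar>\<close>, so \<open>g\<close> is continuous if \<open>x\<close> is, and
  locally Lipschitz if \<open>x\<close> is. For a solution of the first-order system the derivatives of \<open>x\<close>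
  and \<open>y\<close> agree almost everywhere with continuous functions, hence everywhere, so \<open>x\<close> is \<open>C\<^sup>1\<close> and
  \<open>g\<close> is locally Lipschitz.

  What remains is that a Lipschitz curve \<open>u\<close> in a Hilbert space is differentiable almost
  everywhere. The energy \<open>\<Sum> \<bar>K\<bar> \<bar>slope u K\<bar>\<^sup>2\<close> of a division into intervals \<open>K\<close> is bounded, and passing
  to a refinement increases it by \<open>\<Sum> \<bar>J\<bar> \<bar>slope u J - slope u K\<bar>\<^sup>2\<close>, where \<open>J \<subseteq> K\<close>. For a division of nearly
  maximal energy, disjoint intervals \<open>J\<close> whose slope differs from that of their cell by at least \<open>\<eta>\<close>
  therefore have small total length, and by Vitali covering the slopes can oscillate only on a
  null set.
\<close>

section \<open>Almost everywhere differentiability of Lipschitz curves in a Hilbert space\<close>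

text \<open>The slope on a degenerate interval is \<open>0\<close>, since \<open>inverse 0 = 0\<close>.\<close>

definition slope :: "(real \<Rightarrow> 'a::real_normed_vector) \<Rightarrow> real set \<Rightarrow> 'a" where
  "slope u K = (u (Sup K) - u (Inf K)) /\<^sub>R (Sup K - Inf K)"

text \<open>For a division of an interval this is the integral of the squared norm of the derivative
  of the piecewise linear interpolant of \<open>u\<close> at the division points.\<close>

definition energy :: "(real \<Rightarrow> 'a::real_normed_vector) \<Rightarrow> real set set \<Rightarrow> real" where
  "energy u p = (\<Sum>K\<in>p. (Sup K - Inf K) * (norm (slope u K))\<^sup>2)"

lemma division_of_interval_cell:
  fixes p :: "real set set"
  assumes "p division_of S" "K \<in> p"
  obtains c d where "c \<le> d" "K = {c..d}"
  using division_ofD(3,4)[OF assms] by (metis atLeastatMost_empty_iff box_real(2))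

text \<open>Telescoping. Tagging every cell by its left endpoint makes the division a tagged
  division, to which \<open>additive_tagged_division_1\<close> applies.\<close>

lemma sum_increments_division:
  fixes u :: "real \<Rightarrow> 'a::real_normed_vector"
  assumes "a \<le> b" and p: "p division_of {a..b}"
  shows "(\<Sum>K\<in>p. u (Sup K) - u (Inf K)) = u b - u a"
proof -
  have inj: "inj_on (\<lambda>K. (Inf K, K)) p"
    by (auto simp: inj_on_def)
  have "(\<lambda>K. (Inf K, K)) ` p tagged_division_of {a..b}"
    unfolding tagged_division_of
  proof (intro conjI allI impI)
    show "finite ((\<lambda>K. (Inf K, K)) ` p)"
      using p by auto
    show "\<Union>{K. \<exists>x. (x, K) \<in> (\<lambda>K. (Inf K, K)) ` p} = {a..b}"
      using division_ofD(6)[OF p] by (auto simp: image_iff)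
  next
    fix x K assume "(x, K) \<in> (\<lambda>K. (Inf K, K)) ` p"
    then have "K \<in> p" "x = Inf K"
      by auto
    then show "x \<in> K" "K \<subseteq> {a..b}" "\<exists>a b. K = cbox a b"
      using division_ofD(2,4)[OF p \<open>K \<in> p\<close>] division_of_interval_cell[OF p \<open>K \<in> p\<close>]
      by (metis atLeastAtMost_iff cInf_atLeastAtMost order_refl)+
  next
    fix x1 K1 x2 K2
    assume "(x1, K1) \<in> (\<lambda>K. (Inf K, K)) ` p \<and> (x2, K2) \<in> (\<lambda>K. (Inf K, K)) ` p \<and> (x1, K1) \<noteq> (x2, K2)"
    then show "interior K1 \<inter> interior K2 = {}"
      using division_ofD(5)[OF p] by auto
  qed
  from additive_tagged_division_1[OF \<open>a \<le> b\<close> this, of u] show ?thesis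
    by (simp add: sum.reindex[OF inj])
qed

text \<open>A variance identity: by telescoping, the mean of the cell slopes weighted by length is
  \<open>slope u {a..b}\<close>, and a mean square deviation is the mean of the squares minus the
  square of the mean.\<close>

lemma energy_deviation:
  fixes u :: "real \<Rightarrow> 'a::real_inner"
  assumes "a < b" and p: "p division_of {a..b}"
  shows "(\<Sum>K\<in>p. (Sup K - Inf K) * (norm (slope u K - slope u {a..b}))\<^sup>2)
    = energy u p - (b - a) * (norm (slope u {a..b}))\<^sup>2"
proof -
  let ?m = "slope u {a..b}"
  have scale: "(Sup K - Inf K) *\<^sub>R slope u K = u (Sup K) - u (Inf K)" for K
    by (cases "Sup K = Inf K") (auto simp: slope_def)
  have "(Sup K - Inf K) * (norm (slope u K - ?m))\<^sup>2
      = (Sup K - Inf K) * (norm (slope u K))\<^sup>2 - 2 * ((u (Sup K) - u (Inf K)) \<bullet> ?m)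
        + (Sup K - Inf K) * (norm ?m)\<^sup>2" for K
    unfolding scale[symmetric]
    by (simp add: power2_norm_eq_inner inner_diff_left inner_diff_right inner_commute algebra_simps)
  then have "(\<Sum>K\<in>p. (Sup K - Inf K) * (norm (slope u K - ?m))\<^sup>2)
      = energy u p - 2 * ((\<Sum>K\<in>p. u (Sup K) - u (Inf K)) \<bullet> ?m)
        + (\<Sum>K\<in>p. Sup K - Inf K) * (norm ?m)\<^sup>2"
    by (simp only: energy_def sum.distrib sum_subtractf inner_sum_left inner_diff_left
        sum_distrib_left sum_distrib_right right_diff_distrib left_diff_distrib)
  moreover have "(\<Sum>K\<in>p. u (Sup K) - u (Inf K)) = (b - a) *\<^sub>R ?m"
    using sum_increments_division[OF _ p, of u] \<open>a < b\<close> scale[of "{a..b}"] by simp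
  moreover have "(\<Sum>K\<in>p. Sup K - Inf K) = b - a"
    using sum_increments_division[OF _ p, of "\<lambda>x. x"] \<open>a < b\<close> by simp
  ultimately show ?thesis
    by (simp add: power2_norm_eq_inner)
qed

lemma lipschitz_slope_le:
  fixes u :: "real \<Rightarrow> 'a::real_normed_vector"
  assumes u: "L-lipschitz_on {a..b} u" and "a \<le> c" "c \<le> d" "d \<le> b"
  shows "norm (slope u {c..d}) \<le> L"
proof (cases "c = d")
  case True
  then show ?thesis
    using lipschitz_on_nonneg[OF u] by (simp add: slope_def)
next
  case False
  have "norm (u d - u c) \<le> L * (d - c)"
    using lipschitz_on_normD[OF u, of d c] assms by auto
  with False \<open>c \<le> d\<close> show ?thesis
    by (simp add: slope_def divide_inverse_commute[symmetric] divide_le_eq)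
qed

lemma energy_le:
  fixes u :: "real \<Rightarrow> 'a::real_normed_vector"
  assumes u: "L-lipschitz_on {a..b} u" and "a \<le> b" and p: "p division_of {a..b}"
  shows "energy u p \<le> (b - a) * L\<^sup>2"
proof -
  have "energy u p \<le> (\<Sum>K\<in>p. (Sup K - Inf K) * L\<^sup>2)"
    unfolding energy_def
  proof (rule sum_mono)
    fix K assume K: "K \<in> p"
    then obtain c d where cd: "c \<le> d" "K = {c..d}"
      using division_of_interval_cell[OF p] by blast
    moreover have "a \<le> c" "d \<le> b"
      using division_ofD(2)[OF p K] cd by auto
    ultimately have "norm (slope u K) \<le> L"
      using lipschitz_slope_le[OF u] by blast
    then show "(Sup K - Inf K) * (norm (slope u K))\<^sup>2 \<le> (Sup K - Inf K) * L\<^sup>2"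
      using cd by (auto intro!: mult_left_mono power_mono)
  qed
  also have "\<dots> = (b - a) * L\<^sup>2"
    using sum_increments_division[OF _ p, of "\<lambda>x. x"] \<open>a \<le> b\<close> by (simp flip: sum_distrib_right)
  finally show ?thesis .
qed

lemma near_maximal_energy:
  fixes u :: "real \<Rightarrow> 'a::real_normed_vector"
  assumes u: "L-lipschitz_on {a..b} u" and "a \<le> b" and "e > 0"
  obtains p where "p division_of {a..b}" "\<And>q. q division_of {a..b} \<Longrightarrow> energy u q \<le> energy u p + e"
proof -
  let ?E = "energy u ` {p. p division_of {a..b}}"
  have ne: "?E \<noteq> {}"
    using division_of_self[of a b] \<open>a \<le> b\<close> by auto
  have bdd: "bdd_above ?E"
    using energy_le[OF u \<open>a \<le> b\<close>] by (auto intro!: bdd_aboveI2)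
  have "Sup ?E - e < Sup ?E"
    using \<open>e > 0\<close> by simp
  then obtain p where p: "p division_of {a..b}" "Sup ?E - e < energy u p"
    using less_cSup_iff[OF ne bdd] by auto
  have "energy u q \<le> energy u p + e" if "q division_of {a..b}" for q
  proof -
    have "energy u q \<le> Sup ?E"
      using that by (intro cSup_upper bdd) auto
    with p(2) show ?thesis
      by linarith
  qed
  with p(1) show thesis
    by (rule that)
qed

section \<open>Energy gained by refining a division\<close>

lemma division_UN_division:
  assumes p: "p division_of S" and q: "\<And>K. K \<in> p \<Longrightarrow> q K division_of K"
  shows "(\<Union>K\<in>p. q K) division_of S"
proof (rule division_ofI)
  show "finite (\<Union>K\<in>p. q K)"
    using p q by auto
next
  fix J assume "J \<in> (\<Union>K\<in>p. q K)"
  then obtain K where K: "K \<in> p" "J \<in> q K"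
    by auto
  show "J \<subseteq> S"
    using division_ofD(2)[OF q[OF K(1)] K(2)] division_ofD(2)[OF p K(1)] by auto
  show "J \<noteq> {}" "\<exists>a b. J = cbox a b"
    using division_ofD(3,4)[OF q[OF K(1)] K(2)] by auto
next
  fix J1 J2
  assume J: "J1 \<in> (\<Union>K\<in>p. q K)" "J2 \<in> (\<Union>K\<in>p. q K)" "J1 \<noteq> J2"
  then obtain K1 K2 where K: "K1 \<in> p" "J1 \<in> q K1" "K2 \<in> p" "J2 \<in> q K2"
    by auto
  show "interior J1 \<inter> interior J2 = {}"
  proof (cases "K1 = K2")
    case True
    then show ?thesis
      using division_ofD(5)[OF q[OF K(1)], of J1 J2] K J by simp
  next
    case False
    then have "interior K1 \<inter> interior K2 = {}"
      using division_ofD(5)[OF p] K by auto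
    moreover have "J1 \<subseteq> K1" "J2 \<subseteq> K2"
      using division_ofD(2)[OF q] K by auto
    ultimately show ?thesis
      using interior_mono by blast
  qed
next
  have "\<Union>(\<Union>K\<in>p. q K) = (\<Union>K\<in>p. \<Union>(q K))"
    by auto
  also have "\<dots> = (\<Union>K\<in>p. K)"
    using division_ofD(6)[OF q] by simp
  finally show "\<Union>(\<Union>K\<in>p. q K) = S"
    using division_ofD(6)[OF p] by simp
qed

text \<open>The families \<open>q K\<close> may share cells, but a shared cell lies in two cells of
  \<open>p\<close> with disjoint interiors. It is therefore a single point and contributes
  \<open>0\<close>, so nothing is counted twice.\<close>

lemma energy_UN_division:
  fixes u :: "real \<Rightarrow> 'a::real_normed_vector"
  assumes p: "p division_of S" and q: "\<And>K. K \<in> p \<Longrightarrow> q K division_of K"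
  shows "energy u (\<Union>K\<in>p. q K) = (\<Sum>K\<in>p. energy u (q K))"
proof -
  let ?g = "\<lambda>K. (Sup K - Inf K) * (norm (slope u K))\<^sup>2"
  have "(\<Union>K\<in>p. q K) = snd ` Sigma p q"
    by force
  moreover have "sum ?g (snd ` Sigma p q) = sum (?g \<circ> snd) (Sigma p q)"
  proof (rule sum.reindex_nontrivial)
    show "finite (Sigma p q)"
      using p q by auto
  next
    fix X Y assume XY: "X \<in> Sigma p q" "Y \<in> Sigma p q" "X \<noteq> Y" "snd X = snd Y"
    then obtain J K1 K2 where J: "X = (K1, J)" "Y = (K2, J)" "K1 \<in> p" "K2 \<in> p" "K1 \<noteq> K2" "J \<in> q K1" "J \<in> q K2"
      by (cases X, cases Y) auto
    then have "interior J \<subseteq> interior K1 \<inter> interior K2"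
      using division_ofD(2)[OF q] by (simp add: interior_mono)
    then have "interior J = {}"
      using division_ofD(5)[OF p] J by auto
    moreover obtain c d where "c \<le> d" "J = {c..d}"
      using division_of_interval_cell[OF q] J by metis
    ultimately show "?g (snd X) = 0"
      using J by simp
  qed
  moreover have "(\<Sum>K\<in>p. energy u (q K)) = sum (?g \<circ> snd) (Sigma p q)"
    unfolding energy_def using p q by (subst sum.Sigma) (auto simp: case_prod_unfold)
  ultimately show ?thesis
    using p q by (simp add: energy_def)
qed

text \<open>Within each cell \<open>K\<close>, the intervals \<open>J\<close> with
  \<open>k J = K\<close> extend to a division of \<open>K\<close>. Refining \<open>p\<close> by all
  these divisions raises the energy by at least the sum on the left, by
  \<open>energy_deviation\<close>, while \<open>near\<close> caps the gain by
  \<open>e\<close>.\<close>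

lemma sum_deviation_le:
  fixes u :: "real \<Rightarrow> 'a::real_inner"
  assumes p: "p division_of {a..b}"
    and near: "\<And>q. q division_of {a..b} \<Longrightarrow> energy u q \<le> energy u p + e"
    and "finite I"
    and I: "\<And>J. J \<in> I \<Longrightarrow> \<exists>c d. c < d \<and> J = {c..d}"
    and disj: "pairwise disjnt I"
    and cell: "\<And>J. J \<in> I \<Longrightarrow> k J \<in> p \<and> J \<subseteq> k J"
  shows "(\<Sum>J\<in>I. (Sup J - Inf J) * (norm (slope u J - slope u (k J)))\<^sup>2) \<le> e"
proof -
  let ?I = "\<lambda>K. {J \<in> I. k J = K}"
  have "\<exists>q. q division_of K \<and> ?I K \<subseteq> q" if "K \<in> p" for K
  proof -
    have div: "?I K division_of \<Union>(?I K)"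
    proof (rule division_ofI)
      fix J1 J2 assume "J1 \<in> ?I K" "J2 \<in> ?I K" "J1 \<noteq> J2"
      then have "J1 \<inter> J2 = {}"
        using disj by (auto simp: pairwise_def disjnt_def)
      then show "interior J1 \<inter> interior J2 = {}"
        using interior_subset by blast
    next
      fix J assume J: "J \<in> ?I K"
      then obtain c d where "c < d" "J = {c..d}"
        using I[of J] by auto
      then show "J \<noteq> {}" "\<exists>a b. J = cbox a b"
        by (simp, metis box_real(2))
    qed (use \<open>finite I\<close> in auto)
    obtain c d where cd: "K = cbox c d"
      using division_ofD(4)[OF p \<open>K \<in> p\<close>] by auto
    have sub: "\<Union>(?I K) \<subseteq> cbox c d"
      using cell cd by auto
    obtain q where "?I K \<subseteq> q" "q division_of cbox c d"
      by (rule partial_division_extend_interval[OF div sub])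
    then show ?thesis
      using cd by blast
  qed
  then have "\<forall>K\<in>p. \<exists>q. q division_of K \<and> ?I K \<subseteq> q"
    by blast
  from bchoice[OF this]
  obtain q where q: "\<And>K. K \<in> p \<Longrightarrow> q K division_of K" "\<And>K. K \<in> p \<Longrightarrow> ?I K \<subseteq> q K"
    by blast
  let ?f = "\<lambda>K J. (Sup J - Inf J) * (norm (slope u J - slope u K))\<^sup>2"
  have "finite p"
    using p by auto
  have "(\<Sum>J\<in>I. ?f (k J) J) = (\<Sum>K\<in>p. \<Sum>J\<in>?I K. ?f (k J) J)"
    by (rule sum.group[symmetric]) (use cell \<open>finite I\<close> \<open>finite p\<close> in auto)
  also have "\<dots> \<le> (\<Sum>K\<in>p. energy u (q K) - (Sup K - Inf K) * (norm (slope u K))\<^sup>2)"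
  proof (rule sum_mono)
    fix K assume K: "K \<in> p"
    then obtain c d where cd: "c \<le> d" "K = {c..d}"
      using division_of_interval_cell[OF p] by blast
    have nonneg: "0 \<le> ?f K J" "0 \<le> (Sup J - Inf J) * (norm (slope u J))\<^sup>2" if J: "J \<in> q K" for J
    proof -
      obtain c d where "c \<le> d" "J = {c..d}"
        using division_of_interval_cell[OF q(1)[OF K] J] by blast
      then show "0 \<le> ?f K J" "0 \<le> (Sup J - Inf J) * (norm (slope u J))\<^sup>2"
        by auto
    qed
    show "(\<Sum>J\<in>?I K. ?f (k J) J) \<le> energy u (q K) - (Sup K - Inf K) * (norm (slope u K))\<^sup>2"
    \<comment> \<open>\<open>energy_deviation\<close> needs a nondegenerate cell. A one-point cell
      contains no interval of \<open>I\<close> and has length \<open>0\<close>, so only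
      nonnegativity of the energy is left to show.\<close>
    proof (cases "c = d")
      case True
      have empty: "?I K = {}"
      proof (rule ccontr)
        assume "?I K \<noteq> {}"
        then obtain J where "J \<in> I" "J \<subseteq> K"
          using cell by auto
        moreover obtain r s where "r < s" "J = {r..s}"
          using I \<open>J \<in> I\<close> by blast
        ultimately have "r \<in> {c..d}" "s \<in> {c..d}" "r < s"
          using cd by auto
        then show False
          using True by simp
      qed
      have "(\<Sum>J\<in>?I K. ?f (k J) J) = 0"
        unfolding empty by simp
      then show ?thesis
        using True cd nonneg(2) by (auto simp: energy_def intro!: sum_nonneg)
    next
      case False
      have "(\<Sum>J\<in>?I K. ?f (k J) J) = (\<Sum>J\<in>?I K. ?f K J)"
        by (rule sum.cong) auto
      also have "\<dots> \<le> (\<Sum>J\<in>q K. ?f K J)"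
        by (rule sum_mono2) (use q K nonneg(1) in auto)
      also have "\<dots> = energy u (q K) - (Sup K - Inf K) * (norm (slope u K))\<^sup>2"
        using energy_deviation[of c d "q K" u] q(1)[OF K] cd False by simp
      finally show ?thesis .
    qed
  qed
  also have "\<dots> = energy u (\<Union>K\<in>p. q K) - energy u p"
    by (simp add: energy_UN_division[OF p q(1)] sum_subtractf energy_def[of u p])
  also have "\<dots> \<le> e"
    using near[OF division_UN_division[OF p q(1)]] by simp
  finally show ?thesis .
qed

text \<open>If two slopes differ by \<open>2 * \<eta>\<close>, at least one is \<open>\<eta>\<close>
  away from the slope of the surrounding cell. So the points in question, division points aside,
  have arbitrarily short \<open>bad\<close> intervals around them, and Vitali covering extracts
  disjoint ones that cover all but a null set.\<close>

lemma negligible_slope_oscillation: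
  fixes u :: "real \<Rightarrow> 'a::real_inner"
  assumes u: "L-lipschitz_on {a..b} u" and "a < b" and "0 < \<eta>"
  shows "negligible {t \<in> {a<..<b}. \<forall>d>0. \<exists>c e c' e'. c < e \<and> t \<in> {c..e} \<and> e - c < d \<and>
    c' < e' \<and> t \<in> {c'..e'} \<and> e' - c' < d \<and> 2 * \<eta> \<le> norm (slope u {c..e} - slope u {c'..e'})}"
    (is "negligible {t \<in> _. \<forall>d>0. ?P t d}" is "negligible ?B")
  unfolding negligible_outer_le
proof (intro allI impI)
  fix \<epsilon> :: real assume "\<epsilon> > 0"
  with \<open>0 < \<eta>\<close> have pos: "\<epsilon> * \<eta>\<^sup>2 > 0"
    by simp
  \<comment> \<open>The tolerance is \<open>\<epsilon> * \<eta>\<^sup>2\<close> because a bad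
    interval contributes at least \<open>\<eta>\<^sup>2\<close> times its length to the deviation
    sum; disjoint bad intervals then have total length at most \<open>\<epsilon>\<close>.\<close>
  obtain p where p: "p division_of {a..b}"
    and near: "\<And>q. q division_of {a..b} \<Longrightarrow> energy u q \<le> energy u p + \<epsilon> * \<eta>\<^sup>2"
    using near_maximal_energy[OF u less_imp_le[OF \<open>a < b\<close>] pos] by blast
  define bad where "bad = (\<lambda>J K. K \<in> p \<and> J \<subseteq> K \<and> \<eta> \<le> norm (slope u J - slope u K))"
  define V where "V = {(c, e). c < e \<and> (\<exists>K. bad {c..e} K)}"
  \<comment> \<open>The finitely many division points. A point outside \<open>E\<close> is interior
    to its cell, so short enough intervals around it stay inside that cell.\<close>
  define E where "E = Inf ` p \<union> Sup ` p"
  \<comment> \<open>The covering theorem is about balls, so an interval is indexed by its pair of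
    endpoints and rewritten as a ball around its midpoint.\<close>
  have ball: "{c..e} = cball ((c + e) / 2) ((e - c) / 2)" for c e :: real
    by (simp add: cball_eq_atLeastAtMost add_divide_distrib diff_divide_distrib)
  define S where "S = ?B - E"
  have cover: "\<exists>i. i \<in> V \<and> t \<in> cball ((fst i + snd i) / 2) ((snd i - fst i) / 2) \<and> (snd i - fst i) / 2 < d"
    if t: "t \<in> S" and "0 < d" for t d
  proof -
    have "t \<in> \<Union>p"
      unfolding division_ofD(6)[OF p] using t by (simp add: S_def)
    then obtain K where K: "K \<in> p" "t \<in> K"
      by blast
    then obtain k l where kl: "K = {k..l}" "k \<le> l"
      using division_of_interval_cell[OF p] by blast
    then have "k \<in> E" "l \<in> E"
      using K by (auto simp: E_def image_iff intro!: bexI[of _ K])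
    then have "k < t" "t < l"
      using t K kl by (auto simp: S_def order_less_le)
    then have "0 < min d (min (t - k) (l - t))"
      using \<open>0 < d\<close> by simp
    moreover have "\<forall>d>0. ?P t d"
      using t by (simp add: S_def)
    ultimately have "?P t (min d (min (t - k) (l - t)))"
      by blast
    then obtain c e c' e' where ce: "c < e" "t \<in> {c..e}" "e - c < min d (min (t - k) (l - t))"
      "c' < e'" "t \<in> {c'..e'}" "e' - c' < min d (min (t - k) (l - t))"
      and osc: "2 * \<eta> \<le> norm (slope u {c..e} - slope u {c'..e'})"
      by (elim exE conjE) rule
    have "norm (slope u {c..e} - slope u {c'..e'})
        \<le> norm (slope u {c..e} - slope u K) + norm (slope u {c'..e'} - slope u K)"
      using norm_triangle_ineq4[of "slope u {c..e} - slope u K" "slope u {c'..e'} - slope u K"] by simp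
    with osc consider "\<eta> \<le> norm (slope u {c..e} - slope u K)" | "\<eta> \<le> norm (slope u {c'..e'} - slope u K)"
      by linarith
    then show ?thesis
    proof cases
      case 1
      moreover have "{c..e} \<subseteq> K"
        using ce kl by auto
      ultimately have "(c, e) \<in> V"
        using ce K unfolding V_def bad_def by blast
      then show ?thesis
        using ce ball[of c e] \<open>0 < d\<close> by (intro exI[of _ "(c, e)"]) auto
    next
      case 2
      moreover have "{c'..e'} \<subseteq> K"
        using ce kl by auto
      ultimately have "(c', e') \<in> V"
        using ce K unfolding V_def bad_def by blast
      then show ?thesis
        using ce ball[of c' e'] \<open>0 < d\<close> by (intro exI[of _ "(c', e')"]) auto
    qed
  qed
  have radius: "0 < (snd i - fst i) / 2" if "i \<in> V" for i
    using that by (auto simp: V_def)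
  from Vitali_covering_theorem_cballs[of V "\<lambda>i. (snd i - fst i) / 2" S "\<lambda>i. (fst i + snd i) / 2", OF radius cover]
  obtain C where C: "countable C" "C \<subseteq> V"
    and disj: "pairwise (\<lambda>i j. disjnt (cball ((fst i + snd i) / 2) ((snd i - fst i) / 2))
      (cball ((fst j + snd j) / 2) ((snd j - fst j) / 2))) C"
    and neg: "negligible (S - (\<Union>i\<in>C. cball ((fst i + snd i) / 2) ((snd i - fst i) / 2)))"
    by blast
  let ?J = "\<lambda>i. {fst i..snd i}"
  define U where "U = (\<Union>i\<in>C. ?J i)"
  \<comment> \<open>The deviation estimate concerns finite families; a bound uniform over finite
    subfamilies passes to the countable union \<open>U\<close>.\<close>
  have bound: "measure lebesgue (\<Union>i\<in>C'. ?J i) \<le> \<epsilon>" if C': "C' \<subseteq> C" "finite C'" for C'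
  proof -
    let ?I = "?J ` C'"
    have I: "\<exists>c e. c < e \<and> J = {c..e}" "\<exists>K. bad J K" if J: "J \<in> ?I" for J
    proof -
      obtain i where "i \<in> C'" "J = ?J i"
        using J by blast
      moreover from this have "i \<in> V"
        using C' C(2) by blast
      ultimately show "\<exists>c e. c < e \<and> J = {c..e}" "\<exists>K. bad J K"
        by (auto simp: V_def case_prod_unfold)
    qed
    define k where "k = (\<lambda>J. SOME K. bad J K)"
    have k: "bad J (k J)" if "J \<in> ?I" for J
      unfolding k_def using someI_ex[OF I(2)[OF that]] .
    have "measure lebesgue (\<Union>?I) * \<eta>\<^sup>2 \<le> (\<Sum>J\<in>?I. measure lebesgue J) * \<eta>\<^sup>2"
      using C' by (intro mult_right_mono measure_Union_le) auto
    also have "\<dots> \<le> (\<Sum>J\<in>?I. (Sup J - Inf J) * (norm (slope u J - slope u (k J)))\<^sup>2)"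
      unfolding sum_distrib_right
    proof (rule sum_mono)
      fix J assume J: "J \<in> ?I"
      then obtain c e where "c < e" "J = {c..e}"
        using I(1) by blast
      then show "measure lebesgue J * \<eta>\<^sup>2 \<le> (Sup J - Inf J) * (norm (slope u J - slope u (k J)))\<^sup>2"
        using k[OF J] \<open>0 < \<eta>\<close> by (auto simp: bad_def intro!: mult_left_mono power_mono)
    qed
    also have "\<dots> \<le> \<epsilon> * \<eta>\<^sup>2"
    proof (rule sum_deviation_le[OF p near])
      show "pairwise disjnt ?I"
        using pairwise_subset[OF disj C'(1)] by (auto simp: pairwise_def simp flip: ball)
    qed (use C' k I(1) in \<open>auto simp: bad_def\<close>)
    finally show ?thesis
      using \<open>0 < \<eta>\<close> by simp
  qed
  have U: "U \<in> lmeasurable" "measure lebesgue U \<le> \<epsilon>"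
    unfolding U_def
    by (rule fmeasurable_UN_bound[OF C(1) _ bound], simp, assumption, assumption)
      (rule measure_UN_bound[OF C(1) _ bound], simp, assumption, assumption)
  define N where "N = E \<union> (S - U)"
  have "finite E"
    using p by (auto simp: E_def)
  then have N: "negligible N"
    using neg by (auto simp: N_def U_def ball negligible_finite)
  have "?B \<subseteq> U \<union> N"
    by (auto simp: N_def S_def)
  moreover have "U \<union> N \<in> lmeasurable"
    using fmeasurable.Un[OF U(1) negligible_imp_measurable[OF N]] .
  moreover have "measure lebesgue (U \<union> N) \<le> \<epsilon>"
    using measure_Un_le[of U lebesgue N] U N negligible_imp_measure0[OF N] negligible_imp_sets[OF N] by (auto simp: fmeasurableD)
  ultimately show "\<exists>T. ?B \<subseteq> T \<and> T \<in> lmeasurable \<and> measure lebesgue T \<le> \<epsilon>"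
    by blast
qed

text \<open>Off the countably many null sets \<open>B n\<close>, obtained with
  \<open>\<eta> = inverse (Suc n) / 2\<close>, the slopes over intervals shrinking to
  \<open>t\<close> form a Cauchy family, and completeness of the space provides the
  derivative.\<close>

lemma lipschitz_on_differentiable_ae:
  fixes u :: "real \<Rightarrow> 'a::{real_inner, complete_space}"
  assumes u: "L-lipschitz_on {a..b} u" and "a < b"
  shows "negligible {t \<in> {a<..<b}. \<nexists>D. (u has_vector_derivative D) (at t)}"
proof -
  define B where "B = (\<lambda>n::nat. {t \<in> {a<..<b}. \<forall>d>0. \<exists>c e c' e'. c < e \<and> t \<in> {c..e} \<and> e - c < d \<and>
    c' < e' \<and> t \<in> {c'..e'} \<and> e' - c' < d \<and> 2 * (inverse (Suc n) / 2) \<le> norm (slope u {c..e} - slope u {c'..e'})})"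
  have "negligible (B n)" for n
    unfolding B_def by (rule negligible_slope_oscillation[OF u \<open>a < b\<close>]) simp
  then have "negligible (\<Union>n. B n)"
    by (intro negligible_countable_Union) auto
  moreover have "\<exists>D. (u has_vector_derivative D) (at t)" if t: "t \<in> {a<..<b}" "\<And>n. t \<notin> B n" for t
  proof -
    \<comment> \<open>For either sign of \<open>h\<close> the difference quotient is the slope over
      an interval having \<open>t\<close> as an endpoint; this is why the oscillation sets use
      closed intervals.\<close>
    define Q where "Q = (\<lambda>h. (u (t + h) - u t) /\<^sub>R h)"
    have Q: "Q h = slope u {min t (t + h)..max t (t + h)}" if "h \<noteq> 0" for h
    proof (cases "h > 0")
      case False
      then have "Q h = (u t - u (t + h)) /\<^sub>R (- h)"
        by (simp add: Q_def flip: scaleR_minus_right)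
      then show ?thesis
        using False by (simp add: slope_def)
    qed (simp add: Q_def slope_def)
    have osc: "\<exists>d>0. \<forall>h h'. h \<noteq> 0 \<and> h' \<noteq> 0 \<and> \<bar>h\<bar> < d \<and> \<bar>h'\<bar> < d \<longrightarrow> norm (Q h - Q h') < \<epsilon>" if "0 < \<epsilon>" for \<epsilon>
    proof -
      obtain n where n: "inverse (Suc n) < \<epsilon>"
        using reals_Archimedean[OF \<open>0 < \<epsilon>\<close>] by blast
      have "t \<notin> B n" "t \<in> {a<..<b}"
        using t by auto
      then obtain d where "d > 0" and nd: "\<not> (\<exists>c e c' e'. c < e \<and> t \<in> {c..e} \<and> e - c < d \<and>
          c' < e' \<and> t \<in> {c'..e'} \<and> e' - c' < d \<and> 2 * (inverse (Suc n) / 2) \<le> norm (slope u {c..e} - slope u {c'..e'}))"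
        unfolding B_def by blast
      have d: "\<And>c e c' e'. \<lbrakk>c < e; t \<in> {c..e}; e - c < d; c' < e'; t \<in> {c'..e'}; e' - c' < d\<rbrakk>
          \<Longrightarrow> norm (slope u {c..e} - slope u {c'..e'}) < inverse (Suc n)"
        by (rule ccontr, rule notE[OF nd]) (intro exI conjI, assumption+, simp)
      show ?thesis
      proof (intro exI[of _ d] conjI allI impI)
        fix h h' assume h: "h \<noteq> 0 \<and> h' \<noteq> 0 \<and> \<bar>h\<bar> < d \<and> \<bar>h'\<bar> < d"
        then have "norm (slope u {min t (t + h)..max t (t + h)} - slope u {min t (t + h')..max t (t + h')})
            < inverse (Suc n)"
          by (intro d) (auto simp: min_def max_def)
        moreover have "h \<noteq> 0" "h' \<noteq> 0"
          using h by auto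
        ultimately have "norm (Q h - Q h') < inverse (Suc n)"
          by (simp only: Q not_False_eq_True)
        with n show "norm (Q h - Q h') < \<epsilon>"
          by simp
      qed fact
    qed
    \<comment> \<open>The candidate \<open>D\<close> is the limit along one sequence of increments;
      \<open>osc\<close> then carries the convergence over to all increments.\<close>
    define h where "h = (\<lambda>n::nat. inverse (real (Suc n)))"
    have h: "h \<longlonglongrightarrow> 0" "h n \<noteq> 0" "h n > 0" for n
      unfolding h_def by (rule LIMSEQ_inverse_real_of_nat) auto
    have small: "\<forall>\<^sub>F n in sequentially. h n < d" if "d > 0" for d
      using order_tendstoD(2)[OF h(1) that] .
    have "Cauchy (\<lambda>n. Q (h n))"
    proof (rule CauchyI)
      fix \<epsilon> :: real assume "0 < \<epsilon>"
      then obtain d where "d > 0" and d: "\<And>h h'. h \<noteq> 0 \<and> h' \<noteq> 0 \<and> \<bar>h\<bar> < d \<and> \<bar>h'\<bar> < d \<Longrightarrow> norm (Q h - Q h') < \<epsilon>"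
        using osc by meson
      obtain N where "\<And>n. n \<ge> N \<Longrightarrow> h n < d"
        using small[OF \<open>d > 0\<close>] by (auto simp: eventually_sequentially)
      then show "\<exists>N. \<forall>m\<ge>N. \<forall>n\<ge>N. norm (Q (h m) - Q (h n)) < \<epsilon>"
        using h(2,3) by (intro exI[of _ N] allI impI d) (auto simp: abs_of_pos)
    qed
    then obtain D where D: "(\<lambda>n. Q (h n)) \<longlonglongrightarrow> D"
      by (auto simp: Cauchy_convergent_iff convergent_def)
    have "Q \<midarrow>0\<rightarrow> D"
    proof (rule LIM_I)
      fix \<epsilon> :: real assume "0 < \<epsilon>"
      then have "0 < \<epsilon> / 2"
        by simp
      then obtain d where "d > 0" and d: "\<And>h h'. h \<noteq> 0 \<and> h' \<noteq> 0 \<and> \<bar>h\<bar> < d \<and> \<bar>h'\<bar> < d \<Longrightarrow> norm (Q h - Q h') < \<epsilon> / 2"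
        using osc by meson
      have "\<forall>\<^sub>F n in sequentially. norm (Q (h n) - D) < \<epsilon> / 2"
        using tendstoD[OF D \<open>0 < \<epsilon> / 2\<close>] by (simp add: dist_norm)
      then obtain n where n: "norm (Q (h n) - D) < \<epsilon> / 2" "h n < d"
        using eventually_happens[OF eventually_conj[OF _ small[OF \<open>d > 0\<close>]]] by force
      show "\<exists>s>0. \<forall>x. x \<noteq> 0 \<and> norm (x - 0) < s \<longrightarrow> norm (Q x - D) < \<epsilon>"
      proof (intro exI[of _ d] conjI allI impI)
        fix x :: real assume "x \<noteq> 0 \<and> norm (x - 0) < d"
        then have "norm (Q x - Q (h n)) < \<epsilon> / 2"
          using h(2,3) n(2) by (intro d) (auto simp: abs_of_pos)
        with n(1) have "norm ((Q x - Q (h n)) + (Q (h n) - D)) < \<epsilon> / 2 + \<epsilon> / 2"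
          by (intro norm_add_less)
        then show "norm (Q x - D) < \<epsilon>"
          by simp
      qed fact
    qed
    then have lim: "(\<lambda>h. norm (Q h - D)) \<midarrow>0\<rightarrow> 0"
      by (simp add: LIM_zero_iff tendsto_norm_zero_iff)
    have "(\<lambda>h. norm (u (t + h) - u t - h *\<^sub>R D) / norm h) \<midarrow>0\<rightarrow> 0"
    proof (rule Lim_transform_eventually[OF lim])
      have "norm (Q h - D) = norm (u (t + h) - u t - h *\<^sub>R D) / norm h" if "h \<noteq> 0" for h
      proof -
        have "Q h - D = (u (t + h) - u t - h *\<^sub>R D) /\<^sub>R h"
          using that by (simp add: Q_def scaleR_diff_right)
        then show ?thesis
          by (simp add: divide_inverse mult.commute)
      qed
      then show "\<forall>\<^sub>F h in at 0. norm (Q h - D) = norm (u (t + h) - u t - h *\<^sub>R D) / norm h"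
        by (simp add: eventually_at_filter)
    qed
    then have "(u has_vector_derivative D) (at t)"
      by (simp add: has_vector_derivative_def has_derivative_at bounded_linear_scaleR_left)
    then show ?thesis ..
  qed
  ultimately show ?thesis
    by (elim negligible_subset) blast
qed

section \<open>Absolutely continuous curves\<close>

lemma abs_cont_on_intervalE:
  assumes "abs_cont_on_interval u r s" "0 < e"
  obtains d where "0 < d" "\<And>(n::nat) a b. \<lbrakk>\<And>i. i < n \<Longrightarrow> r \<le> a i \<and> a i \<le> b i \<and> b i \<le> s;
      disjoint_family_on (\<lambda>i. {a i<..<b i}) {..<n}; (\<Sum>i<n. b i - a i) < d\<rbrakk>
      \<Longrightarrow> (\<Sum>i<n. norm (u (b i) - u (a i))) < e"
proof -
  have "\<exists>d>0. \<forall>(n::nat) a b. (\<forall>i<n. r \<le> a i \<and> a i \<le> b i \<and> b i \<le> s) \<and>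
      disjoint_family_on (\<lambda>i. {a i<..<b i}) {..<n} \<and> (\<Sum>i<n. b i - a i) < d \<longrightarrow>
      (\<Sum>i<n. norm (u (b i) - u (a i))) < e"
    using assms unfolding abs_cont_on_interval_def by simp
  then show thesis
    using that by auto
qed

text \<open>
  Cousin's lemma: cells of a fine division tagged outside \<open>N\<close> are controlled by the derivative,
  those tagged in \<open>N\<close> lie in an open set of small measure and are controlled by absolute continuity.
\<close>

lemma abs_cont_derivative_bound:
  fixes u :: "real \<Rightarrow> 'a::real_normed_vector"
  assumes ac: "abs_cont_on_interval u a b" and "a \<le> b" and "0 \<le> C" and N: "negligible N"
    and der: "\<And>t. t \<in> {a..b} - N \<Longrightarrow> (u has_vector_derivative u' t) (at t within {a..b})"
    and bound: "\<And>t. t \<in> {a..b} - N \<Longrightarrow> norm (u' t) \<le> C"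
  shows "norm (u b - u a) \<le> C * (b - a)"
proof -
  \<comment> \<open>Here \<open>e\<close> is both the total allowed on cells tagged in
    \<open>N\<close> and the error in the difference quotients elsewhere. Letting it tend to
    \<open>0\<close> at the end gives the claim.\<close>
  have "norm (u b - u a) \<le> e + (C + e) * (b - a)" if "e > 0" for e
  proof -
    obtain d where "d > 0" and d: "\<And>(n::nat) l r. \<lbrakk>\<And>i. i < n \<Longrightarrow> a \<le> l i \<and> l i \<le> r i \<and> r i \<le> b;
        disjoint_family_on (\<lambda>i. {l i<..<r i}) {..<n}; (\<Sum>i<n. r i - l i) < d\<rbrakk>
        \<Longrightarrow> (\<Sum>i<n. norm (u (r i) - u (l i))) < e"
      using abs_cont_on_intervalE[OF ac \<open>e > 0\<close>] by blast
    \<comment> \<open>\<open>d\<close> is the threshold of absolute continuity for \<open>e\<close>.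
      As \<open>N\<close> is null, the open set \<open>T\<close> itself has measure below
      \<open>d\<close>.\<close>
    obtain T where T: "open T" "N \<subseteq> T" "T - N \<in> lmeasurable" "emeasure lebesgue (T - N) < ennreal d"
      using sets_lebesgue_outer_open[OF negligible_imp_sets[OF N] \<open>d > 0\<close>] .
    have TN: "T = (T - N) \<union> N"
      using T(2) by auto
    have "measure lebesgue (T - N) < d"
      using T(3,4) \<open>d > 0\<close> by (simp add: emeasure_eq_measure2 ennreal_less_iff)
    moreover have "measure lebesgue ((T - N) \<union> N) \<le> measure lebesgue (T - N) + measure lebesgue N"
      using T(3) negligible_imp_sets[OF N] by (intro measure_Un_le) (auto simp: fmeasurableD)
    ultimately have T': "T \<in> lmeasurable" "measure lebesgue T < d"
      using fmeasurable.Un[OF T(3) negligible_imp_measurable[OF N]] negligible_imp_measure0[OF N] TN by simp_all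
    have "\<exists>\<delta>>0. \<forall>y\<in>{a..b}. \<bar>y - t\<bar> < \<delta> \<longrightarrow> norm (u y - u t) \<le> (C + e) * \<bar>y - t\<bar>" if t: "t \<in> {a..b} - N" for t
    proof -
      obtain \<delta> where "\<delta> > 0" and \<delta>: "\<And>y. \<lbrakk>y \<in> {a..b}; \<bar>y - t\<bar> < \<delta>\<rbrakk>
          \<Longrightarrow> norm (u y - u t - (y - t) *\<^sub>R u' t) \<le> e * \<bar>y - t\<bar>"
        using der[OF t] \<open>e > 0\<close> unfolding has_vector_derivative_def has_derivative_within_alt real_norm_def
        by blast
      have "norm (u y - u t) \<le> (C + e) * \<bar>y - t\<bar>" if y: "y \<in> {a..b}" "\<bar>y - t\<bar> < \<delta>" for y
      proof -
        have "norm (u y - u t) \<le> norm (u y - u t - (y - t) *\<^sub>R u' t) + \<bar>y - t\<bar> * norm (u' t)"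
          using norm_triangle_ineq[of "u y - u t - (y - t) *\<^sub>R u' t" "(y - t) *\<^sub>R u' t"] by simp
        also have "\<dots> \<le> e * \<bar>y - t\<bar> + \<bar>y - t\<bar> * C"
          by (intro add_mono mult_left_mono \<delta> y bound t) simp
        finally show ?thesis
          by (simp add: algebra_simps)
      qed
      with \<open>\<delta> > 0\<close> show ?thesis
        by blast
    qed
    then obtain \<delta> where \<delta>: "\<And>t. t \<in> {a..b} - N \<Longrightarrow> \<delta> t > 0"
      "\<And>t y. \<lbrakk>t \<in> {a..b} - N; y \<in> {a..b}; \<bar>y - t\<bar> < \<delta> t\<rbrakk> \<Longrightarrow> norm (u y - u t) \<le> (C + e) * \<bar>y - t\<bar>"
      by metis
    \<comment> \<open>A cell tagged in \<open>N\<close> must lie in \<open>T\<close>; a cell with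
      any other tag must lie where the increment bound at its tag holds. Points outside
      \<open>{a..b}\<close> never occur as tags, so \<open>UNIV\<close> is an arbitrary open value
      there.\<close>
    define \<gamma> where "\<gamma> = (\<lambda>t. if t \<in> N then T else if t \<in> {a..b} then ball t (\<delta> t) else UNIV)"
    have "gauge \<gamma>"
      using T \<delta>(1) by (auto simp: gauge_def \<gamma>_def)
    then obtain p where p: "p tagged_division_of {a..b}" and fine: "\<gamma> fine p"
      using fine_division_exists_real by blast
    have fin: "finite p"
      using p by auto
    have cell: "\<exists>l r. K = {l..r} \<and> a \<le> l \<and> l \<le> t \<and> t \<le> r \<and> r \<le> b" if tK: "(t, K) \<in> p" for t K
    proof -
      obtain l r where "K = {l..r}"
        using tagged_division_ofD(4)[OF p tK] by auto
      then show ?thesis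
        using tagged_division_ofD(2,3)[OF p tK] by auto
    qed
    let ?D = "\<lambda>(t, K). norm (u (Sup K) - u (Inf K))"
    let ?N = "{(t, K) \<in> p. t \<in> N}"
    have "u b - u a = (\<Sum>(t, K)\<in>p. u (Sup K) - u (Inf K))"
      using additive_tagged_division_1[OF \<open>a \<le> b\<close> p, of u] by simp
    then have "norm (u b - u a) \<le> sum ?D p"
      using norm_sum[of "\<lambda>(t, K). u (Sup K) - u (Inf K)" p] by (simp add: case_prod_unfold)
    moreover have "sum ?D p = sum ?D ?N + sum ?D (p - ?N)"
      by (subst sum.subset_diff[OF _ fin, of ?N]) (auto simp: add.commute)
    moreover have "sum ?D (p - ?N) \<le> (\<Sum>(t, K)\<in>p - ?N. (C + e) * (Sup K - Inf K))"
    proof (rule sum_mono)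
      fix z assume z: "z \<in> p - ?N"
      obtain t K where tK: "z = (t, K)" "(t, K) \<in> p" "t \<notin> N"
        using z by (cases z) auto
      obtain l r where lr: "K = {l..r}" "a \<le> l" "l \<le> t" "t \<le> r" "r \<le> b"
        using cell[OF tK(2)] by blast
      have "K \<subseteq> ball t (\<delta> t)"
        using fineD[OF fine tK(2)] tK(3) lr by (auto simp: \<gamma>_def)
      moreover have "l \<in> K" "r \<in> K"
        using lr by auto
      ultimately have "l \<in> ball t (\<delta> t)" "r \<in> ball t (\<delta> t)"
        by blast+
      then have "norm (u l - u t) \<le> (C + e) * \<bar>l - t\<bar>" "norm (u r - u t) \<le> (C + e) * \<bar>r - t\<bar>"
        using \<delta>(2)[of t l] \<delta>(2)[of t r] lr tK(3) by (auto simp: dist_real_def abs_minus_commute)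
      \<comment> \<open>The tag splits the cell \<open>{l..r}\<close> into two pieces whose lengths
        add up to \<open>r - l\<close>.\<close>
      then have "norm (u r - u l) \<le> (C + e) * (r - l)"
        using norm_triangle_ineq4[of "u r - u t" "u l - u t"] lr by (simp add: algebra_simps)
      then show "?D z \<le> (case z of (t, K) \<Rightarrow> (C + e) * (Sup K - Inf K))"
        using tK lr by simp
    qed
    moreover have "(\<Sum>(t, K)\<in>p - ?N. (C + e) * (Sup K - Inf K)) \<le> (\<Sum>(t, K)\<in>p. (C + e) * (Sup K - Inf K))"
    proof (rule sum_mono2[OF fin])
      fix z assume "z \<in> p - (p - ?N)"
      then obtain t K where tK: "z = (t, K)" "(t, K) \<in> p"
        by (cases z) auto
      then show "0 \<le> (case z of (t, K) \<Rightarrow> (C + e) * (Sup K - Inf K))"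
        using cell[OF tK(2)] \<open>e > 0\<close> \<open>0 \<le> C\<close> by auto
    qed auto
    moreover have "(\<Sum>(t, K)\<in>p. (C + e) * (Sup K - Inf K)) = (C + e) * (b - a)"
      using additive_tagged_division_1[OF \<open>a \<le> b\<close> p, of "\<lambda>x. x"]
      by (simp add: case_prod_unfold flip: sum_distrib_left)
    moreover have "sum ?D ?N \<le> e"
    proof -
      have "finite ?N"
        using fin by (rule rev_finite_subset) auto
      \<comment> \<open>Absolute continuity is stated for families indexed by an initial segment of
        the naturals, so the cells tagged in \<open>N\<close> are enumerated.\<close>
      then obtain g where g: "bij_betw g {..<card ?N} ?N"
        using ex_bij_betw_nat_finite[OF \<open>finite ?N\<close>] unfolding lessThan_atLeast0 by blast
      define l r where "l = (\<lambda>i. Inf (snd (g i)))" and "r = (\<lambda>i. Sup (snd (g i)))"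
      have gN: "(fst (g i), snd (g i)) \<in> p" "fst (g i) \<in> N" if "i < card ?N" for i
        using bij_betwE[OF g, rule_format, of i] that by auto
      have lr: "snd (g i) = {l i..r i} \<and> a \<le> l i \<and> l i \<le> r i \<and> r i \<le> b" if i: "i < card ?N" for i
      proof -
        obtain c d where "snd (g i) = {c..d}" "a \<le> c" "c \<le> fst (g i)" "fst (g i) \<le> d" "d \<le> b"
          using cell[OF gN(1)[OF i]] by blast
        then show ?thesis
          by (simp add: l_def r_def)
      qed
      have disj: "disjoint_family_on (\<lambda>i. {l i<..<r i}) {..<card ?N}"
        unfolding disjoint_family_on_def
      proof (intro ballI impI)
        fix i j assume ij: "i \<in> {..<card ?N}" "j \<in> {..<card ?N}" "i \<noteq> j"
        then have "g i \<noteq> g j"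
          using g by (auto simp: bij_betw_def inj_on_def)
        then have "interior (snd (g i)) \<inter> interior (snd (g j)) = {}"
          using tagged_division_ofD(5)[OF p gN(1) gN(1), of i j] ij by (auto simp: prod_eq_iff)
        then show "{l i<..<r i} \<inter> {l j<..<r j} = {}"
          using lr ij by simp
      qed
      have "(\<Sum>i<card ?N. r i - l i) = (\<Sum>i<card ?N. measure lebesgue {l i<..<r i})"
        using lr by (intro sum.cong) auto
      also have "\<dots> = measure lebesgue (\<Union>i<card ?N. {l i<..<r i})"
        by (rule measure_UNION'[symmetric])
          (use disj in \<open>auto simp: disjoint_family_on_def pairwise_def disjnt_def\<close>)
      also have "\<dots> \<le> measure lebesgue T"
      proof (rule measure_mono_fmeasurable[OF _ _ T'(1)])
        show "(\<Union>i<card ?N. {l i<..<r i}) \<subseteq> T"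
        proof (rule UN_least)
          fix i assume "i \<in> {..<card ?N}"
          then have i: "i < card ?N"
            by simp
          have "snd (g i) \<subseteq> T"
            using fineD[OF fine gN(1)[OF i]] gN(2)[OF i] by (simp add: \<gamma>_def)
          then show "{l i<..<r i} \<subseteq> T"
            using lr[OF i] greaterThanLessThan_subseteq_atLeastAtMost_iff[of "l i" "r i" "l i" "r i"] by auto
        qed
      qed auto
      finally have "(\<Sum>i<card ?N. norm (u (r i) - u (l i))) < e"
        using lr disj T'(2) by (intro d) auto
      moreover have "sum ?D ?N = (\<Sum>i<card ?N. norm (u (r i) - u (l i)))"
        using sum.reindex_bij_betw[OF g, of ?D] by (simp add: case_prod_unfold l_def r_def)
      ultimately show ?thesis
        by simp
    qed
    ultimately show ?thesis
      by linarith
  qed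
  then have "\<forall>\<^sub>F e in at_right 0. norm (u b - u a) \<le> e + (C + e) * (b - a)"
    by (simp add: eventually_at_filter)
  moreover have "((\<lambda>e. e + (C + e) * (b - a)) \<longlongrightarrow> 0 + (C + 0) * (b - a)) (at_right 0)"
    by (intro tendsto_intros)
  ultimately have "norm (u b - u a) \<le> 0 + (C + 0) * (b - a)"
    by (intro tendsto_lowerbound) auto
  then show ?thesis
    by simp
qed

section \<open>The gradient of the Moreau envelope\<close>

definition subgradient :: "('a::real_inner \<Rightarrow> ereal) \<Rightarrow> 'a \<Rightarrow> 'a \<Rightarrow> bool" where
  "subgradient f p g \<longleftrightarrow> \<bar>f p\<bar> \<noteq> \<infinity> \<and> (\<forall>y. f p + ereal (g \<bullet> (y - p)) \<le> f y)"

lemma subgradientD: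
  assumes "subgradient f p g" "f y = ereal b"
  shows "real_of_ereal (f p) + g \<bullet> (y - p) \<le> b"
proof -
  obtain a where "f p = ereal a"
    using assms(1) by (auto simp: subgradient_def)
  moreover have "f p + ereal (g \<bullet> (y - p)) \<le> f y"
    using assms(1) by (simp add: subgradient_def)
  ultimately show ?thesis
    using assms(2) by simp
qed

lemma subgradient_monotone:
  assumes "subgradient f p g" "subgradient f p' g'"
  shows "0 \<le> (g - g') \<bullet> (p - p')"
proof -
  obtain a a' where a: "f p = ereal a" "f p' = ereal a'"
    using assms by (auto simp: subgradient_def)
  have "a + g \<bullet> (p' - p) \<le> a'" "a' + g' \<bullet> (p - p') \<le> a"
    using subgradientD[OF assms(1) a(2)] subgradientD[OF assms(2) a(1)] a by simp_all
  then show ?thesis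
    by (simp add: inner_diff_left inner_diff_right)
qed

text \<open>With \<open>p = prox\<^bsub>l f\<^esub> x\<close>, the vector \<open>(x - p) /\<^sub>R l\<close> is \<open>\<nabla>f\<^bsub>l\<^esub> x\<close>.\<close>

lemma resolvent_estimate:
  assumes "0 < l" and sub: "subgradient f p ((x - p) /\<^sub>R l)" and sub': "subgradient f p' g'"
  shows "l * norm ((x - p) /\<^sub>R l - g') \<le> norm (x - (p' + l *\<^sub>R g'))"
proof -
  define g where "g = (x - p) /\<^sub>R l"
  have p: "p = x - l *\<^sub>R g"
    using \<open>0 < l\<close> by (simp add: g_def)
  \<comment> \<open>Monotonicity with \<open>p\<close> replaced by \<open>x - l *\<^sub>R g\<close>,
    followed by Cauchy-Schwarz. The vector \<open>g'\<close> is any subgradient at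
    \<open>p'\<close>, so it may come from another parameter or be \<open>0\<close> at a
    minimizer.\<close>
  have "0 \<le> (g - g') \<bullet> (x - l *\<^sub>R g - p')"
    using subgradient_monotone[OF sub sub'] unfolding g_def[symmetric] by (simp only: p)
  also have "x - l *\<^sub>R g - p' = (x - (p' + l *\<^sub>R g')) - l *\<^sub>R (g - g')"
    by (simp add: algebra_simps)
  finally have "l * (norm (g - g'))\<^sup>2 \<le> (g - g') \<bullet> (x - (p' + l *\<^sub>R g'))"
    by (simp only: inner_diff_right[of "g - g'" "x - (p' + l *\<^sub>R g')"] inner_scaleR_right power2_norm_eq_inner)
  also have "\<dots> \<le> norm (g - g') * norm (x - (p' + l *\<^sub>R g'))"
    by (rule norm_cauchy_schwarz)
  finally have "norm (g - g') * (l * norm (g - g')) \<le> norm (g - g') * norm (x - (p' + l *\<^sub>R g'))"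
    by (simp add: power2_eq_square mult_ac)
  then show ?thesis
    unfolding g_def[symmetric] by (cases "g = g'") (auto simp: mult_le_cancel_left)
qed

text \<open>By the subgradient inequality and the expansion of the square, the objective at
  \<open>y\<close> exceeds that at \<open>p\<close> by at least
  \<open>(norm (y - p))\<^sup>2 / (2 * l)\<close>; hence \<open>p\<close> attains the
  infimum.\<close>

lemma moreau_env_eq:
  fixes f :: "'a::real_inner \<Rightarrow> ereal"
  assumes "0 < l" and sub: "subgradient f p ((x - p) /\<^sub>R l)"
  shows "moreau_env f l x = f p + ereal (1 / (2 * l) * (norm (x - p))\<^sup>2)"
  unfolding moreau_env_def
proof (rule antisym)
  have expand: "(Y + 2 * c - X) / (2 * l) = inverse l * c + 1 / (2 * l) * Y - 1 / (2 * l) * X" for X Y c :: real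
    using \<open>0 < l\<close> by (simp add: field_simps)
  show "(INF y. f y + ereal (1 / (2 * l) * (norm (x - y))\<^sup>2)) \<le> f p + ereal (1 / (2 * l) * (norm (x - p))\<^sup>2)"
    by (rule INF_lower) simp
  show "f p + ereal (1 / (2 * l) * (norm (x - p))\<^sup>2) \<le> (INF y. f y + ereal (1 / (2 * l) * (norm (x - y))\<^sup>2))"
  proof (rule INF_greatest)
    fix y
    have "x - y = (x - p) - (y - p)"
      by simp
    then have "(norm (x - y))\<^sup>2 = (norm (x - p))\<^sup>2 - 2 * ((x - p) \<bullet> (y - p)) + (norm (y - p))\<^sup>2"
      by (simp only: power2_norm_eq_inner inner_diff_left[of "x - p"] inner_diff_right[of _ "x - p"]) (simp add: inner_commute)
    then have "0 \<le> ((norm (x - y))\<^sup>2 + 2 * ((x - p) \<bullet> (y - p)) - (norm (x - p))\<^sup>2) / (2 * l)"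
      using \<open>0 < l\<close> by simp
    also have "\<dots> = ((x - p) /\<^sub>R l) \<bullet> (y - p) + 1 / (2 * l) * (norm (x - y))\<^sup>2 - 1 / (2 * l) * (norm (x - p))\<^sup>2"
      unfolding inner_scaleR_left using \<open>0 < l\<close> by (intro expand)
    finally have "1 / (2 * l) * (norm (x - p))\<^sup>2 \<le> ((x - p) /\<^sub>R l) \<bullet> (y - p) + 1 / (2 * l) * (norm (x - y))\<^sup>2"
      by simp
    then have "f p + ereal (1 / (2 * l) * (norm (x - p))\<^sup>2)
        \<le> f p + ereal (((x - p) /\<^sub>R l) \<bullet> (y - p) + 1 / (2 * l) * (norm (x - y))\<^sup>2)"
      by (intro add_left_mono) simp
    also have "\<dots> = (f p + ereal (((x - p) /\<^sub>R l) \<bullet> (y - p))) + ereal (1 / (2 * l) * (norm (x - y))\<^sup>2)"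
      by (simp add: add.assoc)
    also have "\<dots> \<le> f y + ereal (1 / (2 * l) * (norm (x - y))\<^sup>2)"
      using sub unfolding subgradient_def by (intro add_right_mono) blast
    finally show "f p + ereal (1 / (2 * l) * (norm (x - p))\<^sup>2) \<le> f y + ereal (1 / (2 * l) * (norm (x - y))\<^sup>2)" .
  qed
qed

text \<open>Compare \<open>p\<close> with the points
  \<open>(1 - s) *\<^sub>R p + s *\<^sub>R y\<close>, bound \<open>f\<close> there by convexity,
  divide by \<open>s\<close> and let \<open>s\<close> tend to \<open>0\<close> from above.\<close>

lemma minimizer_imp_subgradient:
  fixes f :: "'a::real_inner \<Rightarrow> ereal"
  assumes conv: "convex_fun f" and proper: "proper_fun f" and "0 < l"
    and min: "\<And>y. f p + ereal (1 / (2 * l) * (norm (x - p))\<^sup>2) \<le> f y + ereal (1 / (2 * l) * (norm (x - y))\<^sup>2)"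
  shows "subgradient f p ((x - p) /\<^sub>R l)"
proof -
  obtain w where "f w \<noteq> \<infinity>"
    using proper by (auto simp: proper_fun_def)
  with min[of w] have "f p \<noteq> \<infinity>"
    by auto
  moreover have "f p \<noteq> -\<infinity>"
    using proper by (auto simp: proper_fun_def)
  ultimately obtain a where a: "f p = ereal a"
    by (cases "f p") auto
  have "f p + ereal (((x - p) /\<^sub>R l) \<bullet> (y - p)) \<le> f y" for y
  proof (cases "f y")
    case (real b)
    have expand: "(X - 2 * s * c + s\<^sup>2 * Z) / (2 * l) = X / (2 * l) - s * (inverse l * c) + s * (s * (Z / (2 * l)))"
      for X c Z s :: real
      using \<open>0 < l\<close> by (simp add: field_simps power2_eq_square)
    have combine: "s * (a + G) \<le> s * (b + s * n)"
      if "a + X \<le> (1 - s) * a + s * b + W" "W = X - s * G + s * (s * n)" for X W G s n :: real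
      using that by (simp add: algebra_simps)
    let ?n = "(norm (y - p))\<^sup>2 / (2 * l)"
    have "a + ((x - p) /\<^sub>R l) \<bullet> (y - p) \<le> b + s * ?n" if s: "0 < s" "s < 1" for s
    proof -
      define w where "w = (1 - s) *\<^sub>R p + s *\<^sub>R y"
      have "f w \<le> ereal (1 - s) * f p + ereal s * f y"
        using conv s unfolding convex_fun_def w_def by simp
      then have "f w \<le> ereal ((1 - s) * a + s * b)"
        using a real by simp
      then have "f w + ereal (1 / (2 * l) * (norm (x - w))\<^sup>2) \<le> ereal ((1 - s) * a + s * b) + ereal (1 / (2 * l) * (norm (x - w))\<^sup>2)"
        by (rule add_right_mono)
      from order_trans[OF min[of w] this] have le: "a + 1 / (2 * l) * (norm (x - p))\<^sup>2 \<le> (1 - s) * a + s * b + 1 / (2 * l) * (norm (x - w))\<^sup>2"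
        by (simp add: a)
      have "x - w = (x - p) - s *\<^sub>R (y - p)"
        by (simp add: w_def algebra_simps)
      then have "(norm (x - w))\<^sup>2 = (norm (x - p))\<^sup>2 - 2 * s * ((x - p) \<bullet> (y - p)) + s\<^sup>2 * (norm (y - p))\<^sup>2"
        by (simp only: power2_norm_eq_inner inner_diff_left[of "x - p"] inner_diff_right[of _ "x - p"])
          (simp add: inner_commute power2_eq_square)
      then have "(norm (x - w))\<^sup>2 / (2 * l) = (norm (x - p))\<^sup>2 / (2 * l) - s * (((x - p) /\<^sub>R l) \<bullet> (y - p)) + s * (s * ?n)"
        unfolding inner_scaleR_left by (simp only: expand)
      from combine[OF _ this] le have "s * (a + ((x - p) /\<^sub>R l) \<bullet> (y - p)) \<le> s * (b + s * ?n)"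
        by simp
      then show ?thesis
        using s by simp
    qed
    then have "\<forall>\<^sub>F s in at_right 0. a + ((x - p) /\<^sub>R l) \<bullet> (y - p) \<le> b + s * ?n"
      by (intro eventually_at_rightI[of 0 1]) auto
    moreover have "((\<lambda>s. b + s * ?n) \<longlongrightarrow> b + 0 * ?n) (at_right 0)"
      by (intro tendsto_intros)
    ultimately have "a + ((x - p) /\<^sub>R l) \<bullet> (y - p) \<le> b + 0 * ?n"
      by (intro tendsto_lowerbound) auto
    then show ?thesis
      using a real by simp
  qed (use proper in \<open>auto simp: proper_fun_def\<close>)
  then show ?thesis
    using a by (simp add: subgradient_def)
qed

text \<open>The quadratic term makes every minimizing sequence Cauchy, through the parallelogram law
  at midpoints. Completeness gives a limit and lower semicontinuity makes it a minimizer. The value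
  at \<open>z\<close> bounds the infimum from below, so it is finite.\<close>

lemma minimizer_exists:
  fixes f :: "'a::{real_inner, complete_space} \<Rightarrow> ereal"
  assumes proper: "proper_fun f" and conv: "convex_fun f" and lsc: "lsc_fun f"
    and z: "z \<in> argmin_set f" and "0 < l"
  obtains p where "\<And>y. f p + ereal (1 / (2 * l) * (norm (x - p))\<^sup>2) \<le> f y + ereal (1 / (2 * l) * (norm (x - y))\<^sup>2)"
proof -
  let ?q = "\<lambda>y. 1 / (2 * l) * (norm (x - y))\<^sup>2"
  let ?F = "\<lambda>y. f y + ereal (?q y)"
  have q0: "0 \<le> ?q y" for y
    using \<open>0 < l\<close> by simp
  have notm: "f y \<noteq> -\<infinity>" for y
    using proper by (auto simp: proper_fun_def)
  have zle: "f z \<le> f y" for y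
    using z by (simp add: argmin_set_def)
  obtain w where "f w \<noteq> \<infinity>"
    using proper by (auto simp: proper_fun_def)
  with zle[of w] notm[of z] obtain m where m: "f z = ereal m"
    by (cases "f z") auto
  have "ereal m \<le> ?F y" for y
    using add_mono[of "ereal m" "f y" 0 "ereal (?q y)"] zle[of y] m q0 by simp
  then have "ereal m \<le> (INF y. ?F y)"
    by (intro INF_greatest)
  moreover have "(INF y. ?F y) \<le> ?F z"
    by (rule INF_lower) simp
  ultimately obtain i where i: "(INF y. ?F y) = ereal i"
    using m by (cases "INF y. ?F y") auto
  have iF: "ereal i \<le> ?F y" for y
    unfolding i[symmetric] by (rule INF_lower) simp
  define h where "h = (\<lambda>n::nat. inverse (real (Suc n)))"
  have h: "h \<longlonglongrightarrow> 0" "h n > 0" for n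
    unfolding h_def by (rule LIMSEQ_inverse_real_of_nat) auto
  have "\<exists>y a. f y = ereal a \<and> a + ?q y < i + h n" for n
  proof -
    have "(INF y. ?F y) < ereal (i + h n)"
      using i h by simp
    then obtain y where y: "?F y < ereal (i + h n)"
      unfolding INF_less_iff by blast
    then obtain a where "f y = ereal a"
      using notm[of y] by (cases "f y") auto
    then show ?thesis
      using y by auto
  qed
  then obtain Y A where Y: "\<And>n. f (Y n) = ereal (A n)" "\<And>n. A n + ?q (Y n) < i + h n"
    by metis
  have close: "(norm (Y n - Y k))\<^sup>2 \<le> 4 * l * (h n + h k)" for n k
  proof -
    \<comment> \<open>The objective at the midpoint is at least \<open>i\<close>, yet by the
      parallelogram law it lies below the average of the objectives at \<open>Y n\<close> and
      \<open>Y k\<close> by at least \<open>(norm (Y n - Y k))\<^sup>2 / (8 * l)\<close>.\<close>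
    define w where "w = (1/2) *\<^sub>R Y n + (1/2) *\<^sub>R Y k"
    have "f w \<le> ereal (1/2) * f (Y n) + ereal (1/2) * f (Y k)"
      using conv unfolding convex_fun_def w_def by simp
    then have "f w \<le> ereal (A n / 2 + A k / 2)"
      using Y by simp
    then have "?F w \<le> ereal (A n / 2 + A k / 2) + ereal (?q w)"
      by (rule add_right_mono)
    from order_trans[OF iF this] have le: "i \<le> A n / 2 + A k / 2 + ?q w"
      by simp
    have parallelogram: "(norm (s + t))\<^sup>2 = 2 * (norm s)\<^sup>2 + 2 * (norm t)\<^sup>2 - (norm (s - t))\<^sup>2" for s t :: 'a
      by (simp add: power2_norm_eq_inner inner_add_left inner_add_right inner_diff_left inner_diff_right)
    have "2 *\<^sub>R (x - w) = (x - Y n) + (x - Y k)"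
      by (simp add: w_def scaleR_diff_right scaleR_add_right scaleR_2)
    then have "(norm (2 *\<^sub>R (x - w)))\<^sup>2 = 2 * (norm (x - Y n))\<^sup>2 + 2 * (norm (x - Y k))\<^sup>2 - (norm (Y n - Y k))\<^sup>2"
      by (simp only: parallelogram) (simp add: norm_minus_commute)
    then have "4 * (norm (x - w))\<^sup>2 = 2 * (norm (x - Y n))\<^sup>2 + 2 * (norm (x - Y k))\<^sup>2 - (norm (Y n - Y k))\<^sup>2"
      by (simp add: power2_eq_square)
    then have "(norm (x - w))\<^sup>2 = (norm (x - Y n))\<^sup>2 / 2 + (norm (x - Y k))\<^sup>2 / 2 - (norm (Y n - Y k))\<^sup>2 / 4"
      by simp
    then have "?q w = ?q (Y n) / 2 + ?q (Y k) / 2 - (norm (Y n - Y k))\<^sup>2 / (8 * l)"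
      by (simp add: add_divide_distrib diff_divide_distrib)
    moreover have "D \<le> (hn + hk) / 2"
      if "i \<le> a / 2 + b / 2 + W" "a + X < i + hn" "b + Z < i + hk" "W = X / 2 + Z / 2 - D" for a b W X Z D hn hk :: real
      using that by (simp add: field_simps)
    ultimately have "(norm (Y n - Y k))\<^sup>2 / (8 * l) \<le> (h n + h k) / 2"
      using le Y(2)[of n] Y(2)[of k] by blast
    then show ?thesis
      using \<open>0 < l\<close> by (simp add: field_simps)
  qed
  have "Cauchy Y"
  proof (rule CauchyI)
    fix e :: real assume "e > 0"
    then have "0 < e\<^sup>2 / (8 * l)"
      using \<open>0 < l\<close> by simp
    then obtain N where N: "\<And>n. n \<ge> N \<Longrightarrow> h n < e\<^sup>2 / (8 * l)"
      using order_tendstoD(2)[OF h(1)] by (auto simp: eventually_sequentially)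
    have "norm (Y n - Y k) < e" if "n \<ge> N" "k \<ge> N" for n k
    proof -
      have "h n + h k < e\<^sup>2 / (8 * l) + e\<^sup>2 / (8 * l)"
        using N that by (intro add_strict_mono) auto
      then have "4 * l * (h n + h k) < e\<^sup>2"
        using \<open>0 < l\<close> by (simp add: field_simps)
      with close[of n k] have "(norm (Y n - Y k))\<^sup>2 < e\<^sup>2"
        by linarith
      then show ?thesis
        using \<open>e > 0\<close> by (simp add: power_less_imp_less_base)
    qed
    then show "\<exists>N. \<forall>n\<ge>N. \<forall>k\<ge>N. norm (Y n - Y k) < e"
      by blast
  qed
  then obtain p where p: "Y \<longlonglongrightarrow> p"
    by (auto simp: Cauchy_convergent_iff convergent_def)
  have "f p \<le> ereal (i - ?q p)"
  proof (rule ccontr)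
    assume "\<not> f p \<le> ereal (i - ?q p)"
    then obtain c where c: "ereal (i - ?q p) < ereal c" "ereal c < f p"
      by (meson not_le ereal_dense2)
    have "f p \<le> Liminf (at p) f"
      using lsc by (simp add: lsc_fun_def)
    then have "\<forall>\<^sub>F y in at p. ereal c < f y"
      using c(2) by (simp add: le_Liminf_iff)
    \<comment> \<open>The limit inferior ignores \<open>p\<close> itself, but the sequence may hit
      \<open>p\<close>; there the inequality is the choice of \<open>c\<close>.\<close>
    then have "\<forall>\<^sub>F y in nhds p. ereal c < f y"
      using c(2) by (auto simp: eventually_at_filter elim: eventually_mono)
    then have "\<forall>\<^sub>F n in sequentially. ereal c < f (Y n)"
      using p by (rule eventually_compose_filterlim)
    then have "\<forall>\<^sub>F n in sequentially. c \<le> i + h n - ?q (Y n)"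
    proof (rule eventually_mono)
      fix n assume "ereal c < f (Y n)"
      then have "c < A n"
        by (simp add: Y)
      with Y(2)[of n] show "c \<le> i + h n - ?q (Y n)"
        by linarith
    qed
    moreover have "(\<lambda>n. i + h n - ?q (Y n)) \<longlonglongrightarrow> i + 0 - ?q p"
      by (intro tendsto_intros h p)
    ultimately have "c \<le> i + 0 - ?q p"
      by (intro tendsto_lowerbound) auto
    with c(1) show False
      by simp
  qed
  then have "?F p \<le> ereal (i - ?q p) + ereal (?q p)"
    by (rule add_right_mono)
  then have "?F p \<le> ereal i"
    by simp
  then show thesis
    using that[of p] iF order_trans by blast
qed

section \<open>Differentiability of the envelope\<close>

lemma GDERIV_unique:
  assumes "GDERIV f x :> D" "GDERIV f x :> E"
  shows "D = E"
proof -
  have "(\<lambda>h. h \<bullet> D) = (\<lambda>h. h \<bullet> E)"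
    using assms unfolding gderiv_def by (rule has_derivative_unique)
  then show ?thesis
    by (metis vector_eq_ldot)
qed

lemma GDERIV_quadratic_boundI:
  assumes "0 \<le> C" and bound: "\<And>y. \<bar>f y - f x - (y - x) \<bullet> D\<bar> \<le> C * (norm (y - x))\<^sup>2"
  shows "GDERIV f x :> D"
  unfolding gderiv_def has_derivative_within_alt
proof (intro conjI allI impI)
  show "bounded_linear (\<lambda>h. h \<bullet> D)"
    by (rule bounded_linear_inner_left)
next
  fix e :: real assume "0 < e"
  show "\<exists>d>0. \<forall>y\<in>UNIV. norm (y - x) < d \<longrightarrow> norm (f y - f x - (y - x) \<bullet> D) \<le> e * norm (y - x)"
  \<comment> \<open>\<open>C + 1\<close> is the denominator because \<open>C\<close> may be
    \<open>0\<close>.\<close>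
  proof (intro exI[of _ "e / (C + 1)"] conjI ballI impI)
    fix y assume "norm (y - x) < e / (C + 1)"
    then have "(C + 1) * norm (y - x) < e"
      using \<open>0 \<le> C\<close> by (simp add: pos_less_divide_eq mult.commute)
    moreover have "C * norm (y - x) \<le> (C + 1) * norm (y - x)"
      by (intro mult_right_mono) auto
    ultimately have "C * norm (y - x) \<le> e"
      by linarith
    then have "(C * norm (y - x)) * norm (y - x) \<le> e * norm (y - x)"
      by (rule mult_right_mono) simp
    then show "norm (f y - f x - (y - x) \<bullet> D) \<le> e * norm (y - x)"
      using bound[of y] by (simp add: power2_eq_square)
  qed (use \<open>0 < e\<close> \<open>0 \<le> C\<close> in simp)
qed

lemma resolvent_exists:
  fixes f :: "'a::{real_inner, complete_space} \<Rightarrow> ereal"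
  assumes f: "proper_fun f" "convex_fun f" "lsc_fun f" "argmin_set f \<noteq> {}"
    and "0 < l"
  obtains p where "subgradient f p ((x - p) /\<^sub>R l)"
  using minimizer_exists[OF f(1-3) _ \<open>0 < l\<close>] minimizer_imp_subgradient[OF f(2,1) \<open>0 < l\<close>] f(4)
  by (metis ex_in_conv)

text \<open>Testing the envelope at \<open>y\<close> with the proximal point of \<open>x\<close>
  bounds its increment from above. Exchanging \<open>x\<close> and \<open>y\<close> bounds it from
  below, with the vector belonging to \<open>y\<close> in place of that of \<open>x\<close>;
  \<open>resolvent_estimate\<close> controls their difference.\<close>

lemma moreau_grad_eq:
  fixes f :: "'a::{real_inner, complete_space} \<Rightarrow> ereal"
  assumes f: "proper_fun f" "convex_fun f" "lsc_fun f" "argmin_set f \<noteq> {}"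
    and "0 < l" and sub: "subgradient f p ((x - p) /\<^sub>R l)"
  shows "moreau_grad f l x = (x - p) /\<^sub>R l"
proof -
  let ?g = "(x - p) /\<^sub>R l"
  let ?e = "\<lambda>x. real_of_ereal (moreau_env f l x)"
  have upper: "?e y - ?e x \<le> ((x - p) /\<^sub>R l) \<bullet> (y - x) + (norm (y - x))\<^sup>2 / (2 * l)"
    if sub: "subgradient f p ((x - p) /\<^sub>R l)" for x y p
  proof -
    obtain q where q: "subgradient f q ((y - q) /\<^sub>R l)"
      using resolvent_exists[OF f \<open>0 < l\<close>] .
    obtain a b where ab: "f p = ereal a" "f q = ereal b"
      using sub q by (auto simp: subgradient_def)
    have "moreau_env f l y \<le> f p + ereal (1 / (2 * l) * (norm (y - p))\<^sup>2)"
      unfolding moreau_env_def by (rule INF_lower) simp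
    then have "?e y \<le> a + 1 / (2 * l) * (norm (y - p))\<^sup>2"
      unfolding moreau_env_eq[OF \<open>0 < l\<close> q] by (simp add: ab)
    moreover have "?e x = a + 1 / (2 * l) * (norm (x - p))\<^sup>2"
      unfolding moreau_env_eq[OF \<open>0 < l\<close> sub] by (simp add: ab)
    moreover have "(norm (y - p))\<^sup>2 = (norm (x - p))\<^sup>2 + 2 * ((x - p) \<bullet> (y - x)) + (norm (y - x))\<^sup>2"
    proof -
      have "y - p = (x - p) + (y - x)"
        by simp
      then show ?thesis
        by (simp only: power2_norm_eq_inner inner_add_left inner_add_right) (simp add: inner_commute)
    qed
    moreover have "1 / (2 * l) * (X + 2 * c + Z) = 1 / (2 * l) * X + inverse l * c + Z / (2 * l)" for X c Z :: real
      using \<open>0 < l\<close> by (simp add: field_simps)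
    ultimately show ?thesis
      unfolding inner_scaleR_left by simp
  qed
  \<comment> \<open>The constant is \<open>1 / (2 * l)\<close> from \<open>upper\<close> plus
    \<open>1 / l\<close> from the Lipschitz bound on \<open>?g' - ?g\<close>.\<close>
  have "\<bar>?e y - ?e x - (y - x) \<bullet> ?g\<bar> \<le> 3 / (2 * l) * (norm (y - x))\<^sup>2" for y
  proof -
    obtain q where q: "subgradient f q ((y - q) /\<^sub>R l)"
      using resolvent_exists[OF f \<open>0 < l\<close>] .
    let ?g' = "(y - q) /\<^sub>R l"
    have "l * norm (?g' - ?g) \<le> norm (y - (p + l *\<^sub>R ?g))"
      by (rule resolvent_estimate[OF \<open>0 < l\<close> q sub])
    then have "norm (?g' - ?g) \<le> norm (y - x) / l"
      using \<open>0 < l\<close> by (simp add: pos_le_divide_eq mult.commute)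
    moreover have "\<bar>(?g' - ?g) \<bullet> (y - x)\<bar> \<le> norm (?g' - ?g) * norm (y - x)"
      by (rule Cauchy_Schwarz_ineq2)
    ultimately have "\<bar>(?g' - ?g) \<bullet> (y - x)\<bar> \<le> norm (y - x) / l * norm (y - x)"
      by (meson mult_right_mono norm_ge_zero order_trans)
    then have "\<bar>?g' \<bullet> (y - x) - ?g \<bullet> (y - x)\<bar> \<le> (norm (y - x))\<^sup>2 / l"
      unfolding inner_diff_left[of ?g' ?g] by (simp only: power2_eq_square times_divide_eq_left)
    moreover have "?e y - ?e x \<le> ?g \<bullet> (y - x) + (norm (y - x))\<^sup>2 / (2 * l)"
      by (rule upper[OF sub])
    moreover have "?e x - ?e y \<le> - (?g' \<bullet> (y - x)) + (norm (y - x))\<^sup>2 / (2 * l)"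
      using upper[OF q, of x] by (simp only: norm_minus_commute[of x y] inner_minus_right[symmetric] minus_diff_eq)
    moreover have "3 / (2 * l) * Z = Z / l + Z / (2 * l)" for Z
      using \<open>0 < l\<close> by (simp add: field_simps)
    moreover have "0 \<le> (norm (y - x))\<^sup>2 / l"
      using \<open>0 < l\<close> by simp
    ultimately show ?thesis
      unfolding inner_commute[of "y - x" ?g] abs_le_iff by (simp only: ) linarith
  qed
  then have "GDERIV ?e x :> ?g"
    using \<open>0 < l\<close> by (intro GDERIV_quadratic_boundI[where C = "3 / (2 * l)"]) simp_all
  then show ?thesis
    unfolding moreau_grad_def using GDERIV_unique by (blast intro: the_equality)
qed

text \<open>In \<open>resolvent_estimate\<close> take for \<open>g'\<close> the gradient
  \<open>h\<close> of parameter \<open>l'\<close> at \<open>x'\<close>. Its base point is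
  \<open>q = x' - l' *\<^sub>R h\<close>, so \<open>q + l *\<^sub>R h\<close> differs from
  \<open>x'\<close> by \<open>(l - l') *\<^sub>R h\<close>.\<close>

lemma moreau_grad_diff_le:
  fixes f :: "'a::{real_inner, complete_space} \<Rightarrow> ereal"
  assumes f: "proper_fun f" "convex_fun f" "lsc_fun f" "argmin_set f \<noteq> {}"
    and l: "0 < l" "0 < l'"
  shows "l * norm (moreau_grad f l x - moreau_grad f l' x') \<le> norm (x - x') + \<bar>l - l'\<bar> * norm (moreau_grad f l' x')"
proof -
  obtain p where p: "subgradient f p ((x - p) /\<^sub>R l)"
    using resolvent_exists[OF f l(1)] .
  obtain q where q: "subgradient f q ((x' - q) /\<^sub>R l')"
    using resolvent_exists[OF f l(2)] .
  let ?h = "(x' - q) /\<^sub>R l'"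
  have "x - (q + l *\<^sub>R h) = (x - x') - (l - l') *\<^sub>R h" if "x' - q = l' *\<^sub>R h" for h
    using that by (simp add: algebra_simps)
  moreover have "x' - q = l' *\<^sub>R ?h"
    using l by simp
  ultimately have "x - (q + l *\<^sub>R ?h) = (x - x') - (l - l') *\<^sub>R ?h"
    by blast
  then have "norm (x - (q + l *\<^sub>R ?h)) \<le> norm (x - x') + \<bar>l - l'\<bar> * norm ?h"
    using norm_triangle_ineq4[of "x - x'" "(l - l') *\<^sub>R ?h"] by (simp only: norm_scaleR)
  then show ?thesis
    unfolding moreau_grad_eq[OF f l(1) p] moreau_grad_eq[OF f l(2) q]
    using resolvent_estimate[OF l(1) p q] by linarith
qed

text \<open>At a minimizer \<open>z\<close> the zero vector is a subgradient, so
  \<open>resolvent_estimate\<close> applies with \<open>p' = z\<close> and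
  \<open>g' = 0\<close>.\<close>

lemma moreau_grad_le:
  fixes f :: "'a::{real_inner, complete_space} \<Rightarrow> ereal"
  assumes f: "proper_fun f" "convex_fun f" "lsc_fun f" "argmin_set f \<noteq> {}"
    and "0 < l" and z: "z \<in> argmin_set f"
  shows "l * norm (moreau_grad f l x) \<le> norm (x - z)"
proof -
  obtain w where "f w \<noteq> \<infinity>"
    using f(1) by (auto simp: proper_fun_def)
  then have "\<bar>f z\<bar> \<noteq> \<infinity>"
    using z[unfolded argmin_set_def] f(1) by (auto simp: proper_fun_def)
  then have "subgradient f z 0"
    using z by (simp add: subgradient_def argmin_set_def)
  moreover obtain p where p: "subgradient f p ((x - p) /\<^sub>R l)"
    using resolvent_exists[OF f \<open>0 < l\<close>] .
  ultimately show ?thesis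
    using resolvent_estimate[OF \<open>0 < l\<close> p] moreau_grad_eq[OF f \<open>0 < l\<close> p] by force
qed

section \<open>Locally Lipschitz curves on a half-line\<close>

text \<open>A class between \<open>C1_from\<close> and \<open>loc_abs_cont_from\<close> that is
  stable under sums, products and composition with the gradient of the envelope, which is Lipschitz
  but in general not C1.\<close>

definition loc_lipschitz_from :: "real \<Rightarrow> (real \<Rightarrow> 'a::metric_space) \<Rightarrow> bool" where
  "loc_lipschitz_from t0 u \<longleftrightarrow> (\<forall>s\<ge>t0. \<exists>L. L-lipschitz_on {t0..s} u)"

lemma at_within_halfline:
  fixes t s :: real
  assumes "t < s"
  shows "at t within {t0..s} = at t within {t0..}"
  by (rule at_within_nhd[of t "{..<s}"]) (use assms in auto)

lemma continuous_on_halflineI: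
  fixes u :: "real \<Rightarrow> 'a::topological_space"
  assumes "\<And>s. s \<ge> t0 \<Longrightarrow> continuous_on {t0..s} u"
  shows "continuous_on {t0..} u"
  unfolding continuous_on_eq_continuous_within
proof
  fix t assume "t \<in> {t0..}"
  then have "continuous (at t within {t0..t + 1}) u"
    using assms[of "t + 1"] by (simp add: continuous_on_eq_continuous_within)
  then show "continuous (at t within {t0..}) u"
    by (simp add: at_within_halfline)
qed

lemma loc_lipschitz_from_continuous_on:
  assumes "loc_lipschitz_from t0 u"
  shows "continuous_on {t0..} u"
proof (rule continuous_on_halflineI)
  fix s assume "t0 \<le> s"
  then obtain L where "L-lipschitz_on {t0..s} u"
    using assms by (auto simp: loc_lipschitz_from_def)
  then show "continuous_on {t0..s} u"
    by (rule lipschitz_on_continuous_on)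
qed

section \<open>Sums and products of locally Lipschitz curves\<close>

lemma loc_lipschitz_from_add:
  fixes u v :: "real \<Rightarrow> 'a::real_normed_vector"
  assumes "loc_lipschitz_from t0 u" "loc_lipschitz_from t0 v"
  shows "loc_lipschitz_from t0 (\<lambda>t. u t + v t)"
  unfolding loc_lipschitz_from_def
proof (intro allI impI)
  fix s assume "s \<ge> t0"
  then obtain L M where "L-lipschitz_on {t0..s} u" "M-lipschitz_on {t0..s} v"
    using assms unfolding loc_lipschitz_from_def by metis
  then show "\<exists>L. L-lipschitz_on {t0..s} (\<lambda>t. u t + v t)"
    using lipschitz_on_add by (intro exI)
qed

lemma lipschitz_on_scaleR:
  fixes u :: "'b::metric_space \<Rightarrow> 'a::real_normed_vector" and c :: "'b \<Rightarrow> real"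
  assumes c: "L-lipschitz_on S c" and u: "M-lipschitz_on S u"
    and A: "0 \<le> A" "\<And>t. t \<in> S \<Longrightarrow> \<bar>c t\<bar> \<le> A" and B: "0 \<le> B" "\<And>t. t \<in> S \<Longrightarrow> norm (u t) \<le> B"
  shows "(A * M + L * B)-lipschitz_on S (\<lambda>t. c t *\<^sub>R u t)"
proof (rule lipschitz_onI)
  fix s t assume st: "s \<in> S" "t \<in> S"
  have "c s *\<^sub>R u s - c t *\<^sub>R u t = c s *\<^sub>R (u s - u t) + (c s - c t) *\<^sub>R u t"
    by (simp add: algebra_simps)
  then have "dist (c s *\<^sub>R u s) (c t *\<^sub>R u t) \<le> \<bar>c s\<bar> * dist (u s) (u t) + dist (c s) (c t) * norm (u t)"
    unfolding dist_norm by (metis norm_scaleR norm_triangle_ineq real_norm_def)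
  also have "\<dots> \<le> A * (M * dist s t) + (L * dist s t) * B"
    using st A B lipschitz_onD[OF c] lipschitz_onD[OF u] lipschitz_on_nonneg[OF c]
    by (intro add_mono mult_mono) auto
  finally show "dist (c s *\<^sub>R u s) (c t *\<^sub>R u t) \<le> (A * M + L * B) * dist s t"
    by (simp add: algebra_simps)
qed (use A B lipschitz_on_nonneg[OF c] lipschitz_on_nonneg[OF u] in auto)

lemma continuous_on_halfline_bounded:
  fixes u :: "real \<Rightarrow> 'a::real_normed_vector"
  assumes "continuous_on {t0..} u"
  obtains B where "0 < B" "\<And>t. t \<in> {t0..s} \<Longrightarrow> norm (u t) \<le> B"
proof -
  have "bounded (u ` {t0..s})"
    by (intro compact_imp_bounded compact_continuous_image continuous_on_subset[OF assms]) auto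
  then show thesis
    using that by (auto simp: bounded_pos)
qed

lemma loc_lipschitz_from_scaleR:
  fixes u :: "real \<Rightarrow> 'a::real_normed_vector" and c :: "real \<Rightarrow> real"
  assumes c: "loc_lipschitz_from t0 c" and u: "loc_lipschitz_from t0 u"
  shows "loc_lipschitz_from t0 (\<lambda>t. c t *\<^sub>R u t)"
  unfolding loc_lipschitz_from_def
proof (intro allI impI)
  fix s assume "s \<ge> t0"
  then obtain L where "L-lipschitz_on {t0..s} c"
    using c by (auto simp: loc_lipschitz_from_def)
  moreover from \<open>s \<ge> t0\<close> obtain M where "M-lipschitz_on {t0..s} u"
    using u by (auto simp: loc_lipschitz_from_def)
  moreover obtain A where "0 < A" "\<And>t. t \<in> {t0..s} \<Longrightarrow> norm (c t) \<le> A"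
    using continuous_on_halfline_bounded[OF loc_lipschitz_from_continuous_on[OF c]] by blast
  moreover obtain B where "0 < B" "\<And>t. t \<in> {t0..s} \<Longrightarrow> norm (u t) \<le> B"
    using continuous_on_halfline_bounded[OF loc_lipschitz_from_continuous_on[OF u]] by blast
  ultimately have "(A * M + L * B)-lipschitz_on {t0..s} (\<lambda>t. c t *\<^sub>R u t)"
    by (intro lipschitz_on_scaleR) auto
  then show "\<exists>L. L-lipschitz_on {t0..s} (\<lambda>t. c t *\<^sub>R u t)"
    by blast
qed

lemma loc_lipschitz_from_const: "loc_lipschitz_from t0 (\<lambda>t. c)"
  unfolding loc_lipschitz_from_def using lipschitz_on_constant by blast

lemma C1_from_imp_loc_lipschitz_from:
  fixes u :: "real \<Rightarrow> 'a::real_normed_vector"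
  assumes "C1_from t0 u u'"
  shows "loc_lipschitz_from t0 u"
  unfolding loc_lipschitz_from_def
proof (intro allI impI)
  fix s
  obtain B where B: "0 < B" "\<And>t. t \<in> {t0..s} \<Longrightarrow> norm (u' t) \<le> B"
    using assms continuous_on_halfline_bounded[of t0 u'] unfolding C1_from_def by blast
  have "B-lipschitz_on {t0..s} u"
  proof (rule bounded_derivative_imp_lipschitz)
    fix t assume t: "t \<in> {t0..s}"
    have "(u has_vector_derivative u' t) (at t within {t0..s})"
      using assms t by (auto simp: C1_from_def intro: has_vector_derivative_within_subset)
    then show "(u has_derivative (\<lambda>h. h *\<^sub>R u' t)) (at t within {t0..s})"
      by (simp add: has_vector_derivative_def)
    show "onorm (\<lambda>h. h *\<^sub>R u' t) \<le> B"
      using B(2)[OF t] by (intro onorm_le) (simp add: mult.commute[of B] mult_left_mono)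
  qed (use B in auto)
  then show "\<exists>L. L-lipschitz_on {t0..s} u"
    by blast
qed

lemma C1_from_inverse: "0 < t0 \<Longrightarrow> C1_from t0 (\<lambda>t. c / t) (\<lambda>t. - (c / t\<^sup>2))"
  unfolding C1_from_def
  by (auto intro!: derivative_eq_intros continuous_intros
      simp: power2_eq_square simp flip: has_real_derivative_iff_has_vector_derivative)

section \<open>Rules for absolute continuity\<close>

lemma abs_cont_on_interval_add:
  fixes u v :: "real \<Rightarrow> 'a::real_normed_vector"
  assumes u: "abs_cont_on_interval u r s" and v: "abs_cont_on_interval v r s"
  shows "abs_cont_on_interval (\<lambda>t. u t + v t) r s"
  unfolding abs_cont_on_interval_def
proof (intro allI impI)
  fix e :: real assume "e > 0"
  then have "e / 2 > 0"
    by simp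
  obtain d where "d > 0" and d: "\<And>(n::nat) a b. \<lbrakk>\<And>i. i < n \<Longrightarrow> r \<le> a i \<and> a i \<le> b i \<and> b i \<le> s;
      disjoint_family_on (\<lambda>i. {a i<..<b i}) {..<n}; (\<Sum>i<n. b i - a i) < d\<rbrakk> \<Longrightarrow> (\<Sum>i<n. norm (u (b i) - u (a i))) < e / 2"
    using abs_cont_on_intervalE[OF u \<open>e / 2 > 0\<close>] by blast
  obtain d' where "d' > 0" and d': "\<And>(n::nat) a b. \<lbrakk>\<And>i. i < n \<Longrightarrow> r \<le> a i \<and> a i \<le> b i \<and> b i \<le> s;
      disjoint_family_on (\<lambda>i. {a i<..<b i}) {..<n}; (\<Sum>i<n. b i - a i) < d'\<rbrakk> \<Longrightarrow> (\<Sum>i<n. norm (v (b i) - v (a i))) < e / 2"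
    using abs_cont_on_intervalE[OF v \<open>e / 2 > 0\<close>] by blast
  show "\<exists>d>0. \<forall>(n::nat) a b.
        (\<forall>i<n. r \<le> a i \<and> a i \<le> b i \<and> b i \<le> s) \<and>
        disjoint_family_on (\<lambda>i. {a i<..<b i}) {..<n} \<and>
        (\<Sum>i<n. b i - a i) < d \<longrightarrow>
        (\<Sum>i<n. norm (u (b i) + v (b i) - (u (a i) + v (a i)))) < e"
  proof (intro exI[of _ "min d d'"] conjI allI impI)
    fix n :: nat and a b :: "nat \<Rightarrow> real"
    assume ab: "(\<forall>i<n. r \<le> a i \<and> a i \<le> b i \<and> b i \<le> s) \<and>
      disjoint_family_on (\<lambda>i. {a i<..<b i}) {..<n} \<and> (\<Sum>i<n. b i - a i) < min d d'"
    have "(\<Sum>i<n. norm (u (b i) + v (b i) - (u (a i) + v (a i))))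
        \<le> (\<Sum>i<n. norm (u (b i) - u (a i)) + norm (v (b i) - v (a i)))"
      by (intro sum_mono norm_diff_triangle_ineq)
    also have "\<dots> < e / 2 + e / 2"
      unfolding sum.distrib using ab by (intro add_strict_mono d d') auto
    finally show "(\<Sum>i<n. norm (u (b i) + v (b i) - (u (a i) + v (a i)))) < e"
      by simp
  qed (use \<open>d > 0\<close> \<open>d' > 0\<close> in simp)
qed

text \<open>Serves two purposes: scalar multiples of an absolutely continuous \<open>u\<close>, and,
  with the identity for \<open>u\<close>, Lipschitz curves.\<close>

lemma abs_cont_on_interval_dominated:
  fixes u :: "real \<Rightarrow> 'a::real_normed_vector" and v :: "real \<Rightarrow> 'b::real_normed_vector"
  assumes u: "abs_cont_on_interval u r s" and "0 \<le> L"
    and le: "\<And>a b. \<lbrakk>r \<le> a; a \<le> b; b \<le> s\<rbrakk> \<Longrightarrow> norm (v b - v a) \<le> L * norm (u b - u a)"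
  shows "abs_cont_on_interval v r s"
  unfolding abs_cont_on_interval_def
proof (intro allI impI)
  fix e :: real assume "e > 0"
  then have "e / (L + 1) > 0"
    using \<open>0 \<le> L\<close> by simp
  obtain d where "d > 0" and d: "\<And>(n::nat) a b. \<lbrakk>\<And>i. i < n \<Longrightarrow> r \<le> a i \<and> a i \<le> b i \<and> b i \<le> s;
      disjoint_family_on (\<lambda>i. {a i<..<b i}) {..<n}; (\<Sum>i<n. b i - a i) < d\<rbrakk> \<Longrightarrow> (\<Sum>i<n. norm (u (b i) - u (a i))) < e / (L + 1)"
    using abs_cont_on_intervalE[OF u \<open>e / (L + 1) > 0\<close>] by blast
  show "\<exists>d>0. \<forall>(n::nat) a b.
        (\<forall>i<n. r \<le> a i \<and> a i \<le> b i \<and> b i \<le> s) \<and>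
        disjoint_family_on (\<lambda>i. {a i<..<b i}) {..<n} \<and>
        (\<Sum>i<n. b i - a i) < d \<longrightarrow>
        (\<Sum>i<n. norm (v (b i) - v (a i))) < e"
  proof (intro exI[of _ d] conjI allI impI)
    fix n :: nat and a b :: "nat \<Rightarrow> real"
    assume ab: "(\<forall>i<n. r \<le> a i \<and> a i \<le> b i \<and> b i \<le> s) \<and>
      disjoint_family_on (\<lambda>i. {a i<..<b i}) {..<n} \<and> (\<Sum>i<n. b i - a i) < d"
    have "(\<Sum>i<n. norm (v (b i) - v (a i))) \<le> (\<Sum>i<n. L * norm (u (b i) - u (a i)))"
      using ab by (intro sum_mono le) auto
    also have "\<dots> \<le> (L + 1) * (\<Sum>i<n. norm (u (b i) - u (a i)))"
      by (simp add: sum_nonneg mult_right_mono flip: sum_distrib_left)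
    also have "\<dots> < e"
      using d[of n a b] ab \<open>0 \<le> L\<close> by (simp add: pos_less_divide_eq mult.commute)
    finally show "(\<Sum>i<n. norm (v (b i) - v (a i))) < e" .
  qed fact
qed

lemma abs_cont_on_interval_id: "abs_cont_on_interval (\<lambda>t. t) r s"
  unfolding abs_cont_on_interval_def
proof (intro allI impI)
  fix e :: real assume "e > 0"
  have "(\<Sum>i<n. norm (b i - a i)) = (\<Sum>i<n. b i - a i)" if "\<forall>i<n. r \<le> a i \<and> a i \<le> b i \<and> b i \<le> s"
    for n :: nat and a b :: "nat \<Rightarrow> real"
    using that by (intro sum.cong) auto
  then show "\<exists>d>0. \<forall>(n::nat) a b.
        (\<forall>i<n. r \<le> a i \<and> a i \<le> b i \<and> b i \<le> s) \<and>
        disjoint_family_on (\<lambda>i. {a i<..<b i}) {..<n} \<and>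
        (\<Sum>i<n. b i - a i) < d \<longrightarrow>
        (\<Sum>i<n. norm (b i - a i)) < e"
    using \<open>e > 0\<close> by auto
qed

lemma loc_abs_cont_from_add:
  fixes u v :: "real \<Rightarrow> 'a::real_normed_vector"
  assumes "loc_abs_cont_from t0 u" "loc_abs_cont_from t0 v"
  shows "loc_abs_cont_from t0 (\<lambda>t. u t + v t)"
  using assms abs_cont_on_interval_add unfolding loc_abs_cont_from_def by blast

lemma loc_abs_cont_from_scaleR_const:
  fixes u :: "real \<Rightarrow> 'a::real_normed_vector"
  assumes "loc_abs_cont_from t0 u"
  shows "loc_abs_cont_from t0 (\<lambda>t. c *\<^sub>R u t)"
  unfolding loc_abs_cont_from_def
proof (intro allI impI)
  fix r s assume "t0 \<le> r \<and> r \<le> s"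
  then have "abs_cont_on_interval u r s"
    using assms by (simp add: loc_abs_cont_from_def)
  then show "abs_cont_on_interval (\<lambda>t. c *\<^sub>R u t) r s"
    by (rule abs_cont_on_interval_dominated[where L = "\<bar>c\<bar>"]) (simp_all flip: scaleR_diff_right)
qed

lemma loc_lipschitz_from_imp_loc_abs_cont_from:
  fixes u :: "real \<Rightarrow> 'a::real_normed_vector"
  assumes "loc_lipschitz_from t0 u"
  shows "loc_abs_cont_from t0 u"
  unfolding loc_abs_cont_from_def
proof (intro allI impI)
  fix r s assume rs: "t0 \<le> r \<and> r \<le> s"
  then have "t0 \<le> s"
    by linarith
  then obtain L where L: "L-lipschitz_on {t0..s} u"
    using assms by (auto simp: loc_lipschitz_from_def)
  show "abs_cont_on_interval u r s"
  proof (rule abs_cont_on_interval_dominated[OF abs_cont_on_interval_id lipschitz_on_nonneg[OF L]])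
    fix a b assume "r \<le> a" "a \<le> b" "b \<le> s"
    with rs show "norm (u b - u a) \<le> L * norm (b - a)"
      by (intro lipschitz_on_normD[OF L]) auto
  qed
qed

lemma loc_abs_cont_from_continuous_on:
  fixes u :: "real \<Rightarrow> 'a::real_normed_vector"
  assumes "loc_abs_cont_from t0 u"
  shows "continuous_on {t0..} u"
proof (rule continuous_on_halflineI)
  fix s assume "t0 \<le> s"
  show "continuous_on {t0..s} u"
    unfolding continuous_on_iff
  proof (intro ballI allI impI)
    fix t e :: real assume t: "t \<in> {t0..s}" and "0 < e"
    have "abs_cont_on_interval u t0 s"
      using assms \<open>t0 \<le> s\<close> by (simp add: loc_abs_cont_from_def)
    from abs_cont_on_intervalE[OF this \<open>0 < e\<close>]
    obtain d where "d > 0" and d: "\<And>(n::nat) a b. \<lbrakk>\<And>i. i < n \<Longrightarrow> t0 \<le> a i \<and> a i \<le> b i \<and> b i \<le> s;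
      disjoint_family_on (\<lambda>i. {a i<..<b i}) {..<n}; (\<Sum>i<n. b i - a i) < d\<rbrakk> \<Longrightarrow> (\<Sum>i<n. norm (u (b i) - u (a i))) < e"
      by blast
    \<comment> \<open>A family of one interval; \<open>min\<close> and \<open>max\<close> put its
      endpoints in order whichever side of \<open>t\<close> the point \<open>q\<close> is
      on.\<close>
    have "dist (u q) (u t) < e" if "q \<in> {t0..s}" "dist q t < d" for q
      using d[of 1 "\<lambda>_. min q t" "\<lambda>_. max q t"] that t
      by (cases "q \<le> t") (auto simp: dist_norm disjoint_family_on_def norm_minus_commute)
    then show "\<exists>d>0. \<forall>q\<in>{t0..s}. dist q t < d \<longrightarrow> dist (u q) (u t) < e"
      using \<open>d > 0\<close> by blast
  qed
qed

section \<open>Derivatives almost everywhere on the half-line\<close>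

lemma loc_lipschitz_from_differentiable_ae:
  fixes u :: "real \<Rightarrow> 'a::{real_inner, complete_space}"
  assumes "loc_lipschitz_from t0 u"
  shows "AE t in lebesgue. t0 \<le> t \<longrightarrow> (\<exists>D. (u has_vector_derivative D) (at t within {t0..}))"
proof -
  define B where "B = (\<lambda>n::nat. {t \<in> {t0<..<t0 + Suc n}. \<nexists>D. (u has_vector_derivative D) (at t)})"
  have "negligible (B n)" for n
  proof -
    obtain L where "L-lipschitz_on {t0..t0 + Suc n} u"
      using assms unfolding loc_lipschitz_from_def by (metis le_add_same_cancel1 of_nat_0_le_iff)
    then show ?thesis
      unfolding B_def by (rule lipschitz_on_differentiable_ae) simp
  qed
  \<comment> \<open>The sets \<open>B n\<close> lie in open intervals, where the two-sided
    derivative is used; the endpoint \<open>t0\<close> is put into the null set.\<close>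
  then have "negligible (insert t0 (\<Union>n. B n))"
    by (simp add: negligible_insert) (intro negligible_countable_Union; auto)
  then have null: "insert t0 (\<Union>n. B n) \<in> null_sets lebesgue"
    by (simp add: negligible_iff_null_sets)
  show ?thesis
  proof (rule AE_I'[OF null], rule subsetI)
    fix t assume "t \<in> {t \<in> space lebesgue. \<not> (t0 \<le> t \<longrightarrow> (\<exists>D. (u has_vector_derivative D) (at t within {t0..})))}"
    then have t: "t0 \<le> t" "\<nexists>D. (u has_vector_derivative D) (at t within {t0..})"
      by auto
    obtain n where "t - t0 < real n"
      using reals_Archimedean2 by blast
    moreover have "\<nexists>D. (u has_vector_derivative D) (at t)"
      using t(2) has_vector_derivative_at_within by blast
    ultimately have "t = t0 \<or> t \<in> B n"
      using t(1) by (auto simp: B_def)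
    then show "t \<in> insert t0 (\<Union>n. B n)"
      by blast
  qed
qed

text \<open>Subtract from \<open>u\<close> the linear function with slope \<open>h t\<close>. Near
  \<open>t\<close> the difference \<open>w\<close> has, almost everywhere, a derivative of norm at
  most \<open>e\<close>, since \<open>h\<close> is continuous. By
  \<open>abs_cont_derivative_bound\<close> its increments are at most \<open>e\<close> times the
  length, so \<open>h t\<close> is the derivative at every \<open>t\<close>.\<close>

lemma abs_cont_ae_derivative_imp_C1_from:
  fixes u h :: "real \<Rightarrow> 'a::real_normed_vector"
  assumes ac: "loc_abs_cont_from t0 u" and h: "continuous_on {t0..} h"
    and der: "AE t in lebesgue. t0 \<le> t \<longrightarrow> (u has_vector_derivative h t) (at t within {t0..})"
  shows "C1_from t0 u h"
  unfolding C1_from_def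
proof (intro conjI allI impI h)
  obtain N where N: "N \<in> null_sets lebesgue"
    "{t \<in> space lebesgue. \<not> (t0 \<le> t \<longrightarrow> (u has_vector_derivative h t) (at t within {t0..}))} \<subseteq> N"
    using der unfolding eventually_ae_filter by blast
  fix t assume t: "t0 \<le> t"
  define w where "w = (\<lambda>s. u s + s *\<^sub>R (- h t))"
  have w: "loc_abs_cont_from t0 w"
  proof -
    have "loc_lipschitz_from t0 (\<lambda>s::real. s)"
      unfolding loc_lipschitz_from_def using lipschitz_on_id by blast
    then show ?thesis
      unfolding w_def
      by (intro loc_abs_cont_from_add ac loc_lipschitz_from_imp_loc_abs_cont_from
          loc_lipschitz_from_scaleR loc_lipschitz_from_const)
  qed
  have wd: "(w has_vector_derivative h s - h t) (at s within {t0..})" if "s \<in> {t0..} - N" for s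
  proof -
    have "(u has_vector_derivative h s) (at s within {t0..})"
      using N(2) that by auto
    then have "(w has_vector_derivative h s + (s *\<^sub>R 0 + 1 *\<^sub>R (- h t))) (at s within {t0..})"
      unfolding w_def by (intro has_vector_derivative_add has_vector_derivative_scaleR
          has_vector_derivative_const DERIV_ident)
    then show ?thesis
      by simp
  qed
  show "(u has_vector_derivative h t) (at t within {t0..})"
    unfolding has_vector_derivative_def has_derivative_within_alt
  proof (intro conjI allI impI)
    show "bounded_linear (\<lambda>s. s *\<^sub>R h t)"
      by (rule bounded_linear_scaleR_left)
    fix e :: real assume "0 < e"
    then obtain d where "0 < d" and d: "\<And>s. \<lbrakk>s \<in> {t0..}; dist s t < d\<rbrakk> \<Longrightarrow> dist (h s) (h t) < e"
      using h t unfolding continuous_on_iff by (metis atLeast_iff)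
    have le: "norm (w b - w a) \<le> e * (b - a)" if ab: "t0 \<le> a" "a \<le> b" "{a..b} \<subseteq> ball t d" for a b
    proof (rule abs_cont_derivative_bound)
      show "abs_cont_on_interval w a b"
        using w ab by (simp add: loc_abs_cont_from_def)
      show "negligible N"
        using N by (simp add: negligible_iff_null_sets)
      fix s assume s: "s \<in> {a..b} - N"
      with ab have "s \<in> {t0..} - N" "s \<in> ball t d"
        by auto
      then show "norm (h s - h t) \<le> e"
        using d[of s] by (simp add: dist_norm abs_minus_commute less_imp_le)
      show "(w has_vector_derivative h s - h t) (at s within {a..b})"
        using wd[OF \<open>s \<in> {t0..} - N\<close>] by (rule has_vector_derivative_within_subset) (use ab in auto)
    qed (use ab \<open>0 < e\<close> in auto)
    show "\<exists>d>0. \<forall>y\<in>{t0..}. norm (y - t) < d \<longrightarrow> norm (u y - u t - (y - t) *\<^sub>R h t) \<le> e * norm (y - t)"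
    proof (intro exI[of _ d] conjI ballI impI)
      fix y assume y: "y \<in> {t0..}" "norm (y - t) < d"
      have w_diff: "u y - u t - (y - t) *\<^sub>R h t = w y - w t"
        by (simp add: w_def algebra_simps)
      show "norm (u y - u t - (y - t) *\<^sub>R h t) \<le> e * norm (y - t)"
      proof (cases "t \<le> y")
        case True
        then have "norm (w y - w t) \<le> e * (y - t)"
          using y t by (intro le) (auto simp: dist_real_def)
        then show ?thesis
          using True by (simp add: w_diff)
      next
        case False
        then have "norm (w t - w y) \<le> e * (t - y)"
          using y t by (intro le) (auto simp: dist_real_def)
        then show ?thesis
          using False by (simp add: w_diff norm_minus_commute)
      qed
    qed fact
  qed
qed

section \<open>Equivalence of the two systems\<close>

text \<open>Makes \<open>moreau_grad_diff_le\<close> uniform on \<open>{t0..s}\<close>: by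
  compactness \<open>\<gamma>\<close> has a positive minimum \<open>c\<close>, and
  \<open>moreau_grad_le\<close> with a bound on \<open>x - z\<close> gives a common bound
  \<open>M\<close> for the gradients. Continuity and Lipschitz continuity along the path both
  follow.\<close>

lemma moreau_grad_path_bounds:
  fixes f :: "'a::{real_inner, complete_space} \<Rightarrow> ereal" and x :: "real \<Rightarrow> 'a"
  assumes f: "proper_fun f" "convex_fun f" "lsc_fun f" "argmin_set f \<noteq> {}"
    and x: "continuous_on {t0..} x" and \<gamma>: "continuous_on {t0..} \<gamma>" "\<And>t. t \<ge> t0 \<Longrightarrow> \<gamma> t > 0"
    and "t0 \<le> s"
  obtains c M where "0 < c" "0 \<le> M"
    "\<And>t r. \<lbrakk>t \<in> {t0..s}; r \<in> {t0..s}\<rbrakk> \<Longrightarrow> norm (moreau_grad f (\<gamma> t) (x t) - moreau_grad f (\<gamma> r) (x r))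
      \<le> (norm (x t - x r) + \<bar>\<gamma> t - \<gamma> r\<bar> * M) / c"
proof -
  let ?G = "\<lambda>t. moreau_grad f (\<gamma> t) (x t)"
  have "continuous_on {t0..s} \<gamma>"
    by (rule continuous_on_subset[OF \<gamma>(1)]) auto
  then have "\<exists>t1\<in>{t0..s}. \<forall>t\<in>{t0..s}. \<gamma> t1 \<le> \<gamma> t"
    by (intro continuous_attains_inf) (use \<open>t0 \<le> s\<close> in auto)
  then obtain t1 where t1: "t1 \<in> {t0..s}" "\<And>t. t \<in> {t0..s} \<Longrightarrow> \<gamma> t1 \<le> \<gamma> t"
    by blast
  obtain z where z: "z \<in> argmin_set f"
    using f by blast
  have "continuous_on {t0..} (\<lambda>t. x t - z)"
    by (intro continuous_intros x)
  then obtain K where K: "0 < K" "\<And>t. t \<in> {t0..s} \<Longrightarrow> norm (x t - z) \<le> K"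
    using continuous_on_halfline_bounded by blast
  define c M where "c = \<gamma> t1" and "M = K / c"
  have c: "0 < c" "\<And>t. t \<in> {t0..s} \<Longrightarrow> c \<le> \<gamma> t"
    using t1 \<gamma>(2) by (auto simp: c_def)
  have M: "norm (?G t) \<le> M" if t: "t \<in> {t0..s}" for t
  proof -
    have "c * norm (?G t) \<le> \<gamma> t * norm (?G t)"
      by (intro mult_right_mono c t) simp
    also have "\<dots> \<le> norm (x t - z)"
      by (intro moreau_grad_le f z \<gamma>(2)) (use t in auto)
    also have "\<dots> \<le> K"
      by (rule K(2)[OF t])
    finally show ?thesis
      using c(1) by (simp add: M_def pos_le_divide_eq mult.commute)
  qed
  show thesis
  proof
    show "0 < c" "0 \<le> M"
      using c K by (auto simp: M_def)
    fix t r assume tr: "t \<in> {t0..s}" "r \<in> {t0..s}"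
    have "c * norm (?G t - ?G r) \<le> \<gamma> t * norm (?G t - ?G r)"
      by (intro mult_right_mono c tr) simp
    also have "\<dots> \<le> norm (x t - x r) + \<bar>\<gamma> t - \<gamma> r\<bar> * norm (?G r)"
      by (intro moreau_grad_diff_le f \<gamma>(2)) (use tr in auto)
    also have "\<dots> \<le> norm (x t - x r) + \<bar>\<gamma> t - \<gamma> r\<bar> * M"
      by (intro add_left_mono mult_left_mono M tr) simp
    finally show "norm (?G t - ?G r) \<le> (norm (x t - x r) + \<bar>\<gamma> t - \<gamma> r\<bar> * M) / c"
      using c(1) by (simp add: pos_le_divide_eq mult.commute)
  qed
qed

lemma continuous_on_moreau_grad_path:
  fixes f :: "'a::{real_inner, complete_space} \<Rightarrow> ereal" and x :: "real \<Rightarrow> 'a"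
  assumes f: "proper_fun f" "convex_fun f" "lsc_fun f" "argmin_set f \<noteq> {}"
    and x: "continuous_on {t0..} x" and \<gamma>: "continuous_on {t0..} \<gamma>" "\<And>t. t \<ge> t0 \<Longrightarrow> \<gamma> t > 0"
  shows "continuous_on {t0..} (\<lambda>t. moreau_grad f (\<gamma> t) (x t))"
proof (rule continuous_on_halflineI)
  let ?G = "\<lambda>t. moreau_grad f (\<gamma> t) (x t)"
  fix s assume "t0 \<le> s"
  obtain c M where "0 < c" "0 \<le> M" and le: "\<And>t r. \<lbrakk>t \<in> {t0..s}; r \<in> {t0..s}\<rbrakk> \<Longrightarrow> norm (?G t - ?G r)
      \<le> (norm (x t - x r) + \<bar>\<gamma> t - \<gamma> r\<bar> * M) / c"
    using moreau_grad_path_bounds[OF f x \<gamma> \<open>t0 \<le> s\<close>] by blast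
  have xs: "continuous_on {t0..s} x" and \<gamma>s: "continuous_on {t0..s} \<gamma>"
    using x \<gamma>(1) by (auto elim: continuous_on_subset)
  show "continuous_on {t0..s} ?G"
    unfolding continuous_on_def
  proof
    fix t assume t: "t \<in> {t0..s}"
    have "((\<lambda>r. (norm (x r - x t) + \<bar>\<gamma> r - \<gamma> t\<bar> * M) / c) \<longlongrightarrow> (norm (x t - x t) + \<bar>\<gamma> t - \<gamma> t\<bar> * M) * inverse c) (at t within {t0..s})"
      using xs \<gamma>s t unfolding divide_inverse by (intro tendsto_intros) (auto simp: continuous_on_def)
    then have "((\<lambda>r. (norm (x r - x t) + \<bar>\<gamma> r - \<gamma> t\<bar> * M) / c) \<longlongrightarrow> 0) (at t within {t0..s})"
      by simp
    moreover have "\<forall>\<^sub>F r in at t within {t0..s}. norm (?G r - ?G t) \<le> (norm (x r - x t) + \<bar>\<gamma> r - \<gamma> t\<bar> * M) / c"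
      using le t by (simp add: eventually_at_filter)
    ultimately have "((\<lambda>r. ?G r - ?G t) \<longlongrightarrow> 0) (at t within {t0..s})"
      by (rule Lim_null_comparison[rotated])
    then show "(?G \<longlongrightarrow> ?G t) (at t within {t0..s})"
      by (rule LIM_zero_cancel)
  qed
qed

lemma loc_lipschitz_from_moreau_grad_path:
  fixes f :: "'a::{real_inner, complete_space} \<Rightarrow> ereal" and x :: "real \<Rightarrow> 'a"
  assumes f: "proper_fun f" "convex_fun f" "lsc_fun f" "argmin_set f \<noteq> {}"
    and x: "loc_lipschitz_from t0 x" and \<gamma>: "loc_lipschitz_from t0 \<gamma>" "\<And>t. t \<ge> t0 \<Longrightarrow> \<gamma> t > 0"
  shows "loc_lipschitz_from t0 (\<lambda>t. moreau_grad f (\<gamma> t) (x t))"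
  unfolding loc_lipschitz_from_def
proof (intro allI impI)
  let ?G = "\<lambda>t. moreau_grad f (\<gamma> t) (x t)"
  fix s assume "t0 \<le> s"
  note cont = loc_lipschitz_from_continuous_on
  obtain c M where cM: "0 < c" "0 \<le> M" and le: "\<And>t r. \<lbrakk>t \<in> {t0..s}; r \<in> {t0..s}\<rbrakk> \<Longrightarrow> norm (?G t - ?G r)
      \<le> (norm (x t - x r) + \<bar>\<gamma> t - \<gamma> r\<bar> * M) / c"
    using moreau_grad_path_bounds[OF f cont[OF x] cont[OF \<gamma>(1)] \<gamma>(2) \<open>t0 \<le> s\<close>] by blast
  obtain L where L: "L-lipschitz_on {t0..s} x"
    using x \<open>t0 \<le> s\<close> by (auto simp: loc_lipschitz_from_def)
  obtain L' where L': "L'-lipschitz_on {t0..s} \<gamma>"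
    using \<gamma>(1) \<open>t0 \<le> s\<close> by (auto simp: loc_lipschitz_from_def)
  have "((L + L' * M) / c)-lipschitz_on {t0..s} ?G"
  proof (rule lipschitz_onI)
    fix t r assume tr: "t \<in> {t0..s}" "r \<in> {t0..s}"
    have "norm (x t - x r) + \<bar>\<gamma> t - \<gamma> r\<bar> * M \<le> L * dist t r + (L' * dist t r) * M"
      using lipschitz_onD[OF L tr] lipschitz_onD[OF L' tr] cM
      by (intro add_mono mult_right_mono) (auto simp: dist_norm)
    also have "\<dots> = (L + L' * M) * dist t r"
      by (simp add: algebra_simps)
    finally have "(norm (x t - x r) + \<bar>\<gamma> t - \<gamma> r\<bar> * M) / c \<le> (L + L' * M) * dist t r / c"
      using cM by (intro divide_right_mono) auto
    with le[OF tr] show "dist (?G t) (?G r) \<le> (L + L' * M) / c * dist t r"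
      by (simp add: dist_norm)
  qed (use cM lipschitz_on_nonneg[OF L] lipschitz_on_nonneg[OF L'] in auto)
  then show "\<exists>L. L-lipschitz_on {t0..s} ?G"
    by blast
qed

text \<open>Reduces linear identities between vectors to field identities between real numbers.\<close>

lemma inner_eq_zeroI:
  fixes v :: "'a::real_inner"
  assumes "\<And>w. w \<bullet> v = 0"
  shows "v = 0"
  using assms[of v] by simp

theorem theorem2p1:
  fixes f :: "'a::{real_inner, complete_space} \<Rightarrow> ereal"
    and \<alpha> \<beta> t0 :: real
    and \<delta> \<gamma> :: "real \<Rightarrow> real"
    and x0 v0 y0 :: 'a
    and x :: "real \<Rightarrow> 'a"
  assumes "proper_fun f" and "convex_fun f" and "lsc_fun f"
    and "argmin_set f \<noteq> {}"
    and "\<alpha> > 0" and "\<beta> > 0" and "t0 > 0"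
    and "\<And>t. t \<ge> t0 \<Longrightarrow> \<delta> t > 0" and "\<And>t. t \<ge> t0 \<Longrightarrow> \<gamma> t > 0"
    and "\<exists>\<delta>'. C1_from t0 \<delta> \<delta>'" and "\<exists>\<gamma>'. C1_from t0 \<gamma> \<gamma>'"
    and "v0 = - ((\<beta> * \<delta> t0) *\<^sub>R moreau_grad f (\<gamma> t0) x0)
              - ((\<alpha> - 1) / t0 - 1 / \<beta>) *\<^sub>R x0 - (1 / \<beta>) *\<^sub>R y0"
  shows "second_order_solution f \<alpha> \<beta> \<delta> \<gamma> t0 x0 v0 x \<longleftrightarrow>
         (\<exists>y. first_order_solution f \<alpha> \<beta> \<delta> \<gamma> t0 x0 y0 x y)"
proof
  note f = assms(1-4) and \<gamma>pos = assms(9) and v0 = assms(12)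
  define G where "G = (\<lambda>t. moreau_grad f (\<gamma> t) (x t))"
  define g where "g = (\<lambda>t. \<delta> t *\<^sub>R G t)"
  have \<delta>: "loc_lipschitz_from t0 \<delta>" and \<gamma>: "loc_lipschitz_from t0 \<gamma>"
    using assms(10,11) C1_from_imp_loc_lipschitz_from by blast+
  have lip_inverse: "loc_lipschitz_from t0 (\<lambda>t. c / t)" for c :: real
    using C1_from_imp_loc_lipschitz_from[OF C1_from_inverse[OF \<open>t0 > 0\<close>]] .
  have der_inverse: "((\<lambda>t. c / t) has_field_derivative - (c / t\<^sup>2)) (at t within {t0..})" if "t0 \<le> t" for c t :: real
    using C1_from_inverse[OF \<open>t0 > 0\<close>, of c] that
    by (auto simp: C1_from_def has_real_derivative_iff_has_vector_derivative)
  have g_lip: "loc_lipschitz_from t0 g" if "loc_lipschitz_from t0 x"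
    unfolding g_def G_def
    by (intro loc_lipschitz_from_scaleR \<delta> loc_lipschitz_from_moreau_grad_path f that \<gamma> \<gamma>pos)
  \<comment> \<open>The curves below are written as right-nested sums of scalar multiples, so that
    these rules match their shape directly.\<close>
  note lip_intros = loc_lipschitz_from_add loc_lipschitz_from_scaleR loc_lipschitz_from_const lip_inverse
  note vd_intros = has_vector_derivative_add bounded_linear.has_vector_derivative[OF bounded_linear_scaleR_right]
    has_vector_derivative_scaleR der_inverse
  note inner_simps = inner_add_right inner_diff_right inner_minus_right inner_scaleR_right inner_zero_right

  \<comment> \<open>From the second-order equation to the system\<close>
  {
    assume "second_order_solution f \<alpha> \<beta> \<delta> \<gamma> t0 x0 v0 x"
    then obtain xd where C1: "C1_from t0 x xd" and ac: "loc_abs_cont_from t0 xd"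
      and ae: "AE t in lebesgue. t0 \<le> t \<longrightarrow> (\<exists>xdd gd. (xd has_vector_derivative xdd) (at t within {t0..}) \<and>
        (g has_vector_derivative gd) (at t within {t0..}) \<and>
        xdd + (\<alpha> / t) *\<^sub>R xd t + \<beta> *\<^sub>R gd + ((1 + \<beta> / t) * \<delta> t) *\<^sub>R G t = 0)"
      and init: "x t0 = x0" "xd t0 = v0"
      unfolding second_order_solution_def g_def G_def by blast
    define c where "c = - (\<beta> * (\<alpha> - 1))"
    \<comment> \<open>The first equation of the system solved for \<open>y\<close>, with
      \<open>c / t\<close> collecting the coefficient of \<open>x\<close> that depends on
      \<open>t\<close>. Only the \<open>xd\<close> term is merely absolutely continuous; the other
      terms are locally Lipschitz.\<close>
    define y where "y = (\<lambda>t. (- \<beta>) *\<^sub>R xd t + ((- (\<beta>\<^sup>2)) *\<^sub>R g t + ((c / t) *\<^sub>R x t + x t)))"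
    note x_lip = C1_from_imp_loc_lipschitz_from[OF C1]
    have eq1: "xd t + (\<beta> * \<delta> t) *\<^sub>R G t + ((\<alpha> - 1) / t - 1 / \<beta>) *\<^sub>R x t + (1 / \<beta>) *\<^sub>R y t = 0" if "t0 \<le> t" for t
      by (rule inner_eq_zeroI) (use that \<open>t0 > 0\<close> \<open>\<beta> > 0\<close> in
        \<open>simp add: inner_simps y_def c_def g_def field_simps power2_eq_square\<close>)
    have "first_order_solution f \<alpha> \<beta> \<delta> \<gamma> t0 x0 y0 x y"
      unfolding first_order_solution_def
    proof (intro conjI)
      show "loc_abs_cont_from t0 x"
        by (rule loc_lipschitz_from_imp_loc_abs_cont_from[OF x_lip])
      show "loc_abs_cont_from t0 y"
        unfolding y_def
        by (intro loc_abs_cont_from_add[OF loc_abs_cont_from_scaleR_const[OF ac]]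
            loc_lipschitz_from_imp_loc_abs_cont_from lip_intros g_lip x_lip)
      show "x t0 = x0"
        by (rule init)
      \<comment> \<open>Here the relation imposed on \<open>v0\<close> enters.\<close>
      show "y t0 = y0"
      proof -
        have "y t0 - y0 = 0"
          by (rule inner_eq_zeroI) (use \<open>t0 > 0\<close> \<open>\<beta> > 0\<close> in
            \<open>simp add: inner_simps y_def c_def g_def G_def init v0 field_simps power2_eq_square\<close>)
        then show ?thesis
          by simp
      qed
      show "AE t in lebesgue. t0 \<le> t \<longrightarrow> (\<exists>xd yd. (x has_vector_derivative xd) (at t within {t0..}) \<and>
          (y has_vector_derivative yd) (at t within {t0..}) \<and>
          xd + (\<beta> * \<delta> t) *\<^sub>R moreau_grad f (\<gamma> t) (x t) + ((\<alpha> - 1) / t - 1 / \<beta>) *\<^sub>R x t + (1 / \<beta>) *\<^sub>R y t = 0 \<and>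
          yd - (1 / \<beta> - (\<alpha> - 2) / t) *\<^sub>R x t + (1 / t + 1 / \<beta>) *\<^sub>R y t = 0)"
        using ae
      proof eventually_elim
        case (elim t)
        show ?case
        proof
          assume t: "t0 \<le> t"
          with elim obtain xdd gd where xdd: "(xd has_vector_derivative xdd) (at t within {t0..})"
            and gd: "(g has_vector_derivative gd) (at t within {t0..})"
            and eq: "xdd + (\<alpha> / t) *\<^sub>R xd t + \<beta> *\<^sub>R gd + ((1 + \<beta> / t) * \<delta> t) *\<^sub>R G t = 0"
            by blast
          have x: "(x has_vector_derivative xd t) (at t within {t0..})"
            using C1 \<open>t0 \<le> t\<close> by (simp add: C1_from_def)
          define yd where "yd = (- \<beta>) *\<^sub>R xdd + ((- (\<beta>\<^sup>2)) *\<^sub>R gd + (((c / t) *\<^sub>R xd t + (- (c / t\<^sup>2)) *\<^sub>R x t) + xd t))"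
          have y: "(y has_vector_derivative yd) (at t within {t0..})"
            unfolding y_def yd_def by (intro vd_intros xdd gd x \<open>t0 \<le> t\<close>)
          \<comment> \<open>The second-order equation eliminates \<open>xdd\<close>; the terms in
            \<open>gd\<close> then cancel, leaving a field identity.\<close>
          have "yd - (1 / \<beta> - (\<alpha> - 2) / t) *\<^sub>R x t + (1 / t + 1 / \<beta>) *\<^sub>R y t = 0"
          proof (rule inner_eq_zeroI)
            fix w
            have "w \<bullet> (xdd + (\<alpha> / t) *\<^sub>R xd t + \<beta> *\<^sub>R gd + ((1 + \<beta> / t) * \<delta> t) *\<^sub>R G t) = 0"
              by (simp add: eq)
            then have xdd_eq: "w \<bullet> xdd = - ((\<alpha> / t) * (w \<bullet> xd t) + \<beta> * (w \<bullet> gd) + ((1 + \<beta> / t) * \<delta> t) * (w \<bullet> G t))"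
              by (simp add: inner_simps)
            show "w \<bullet> (yd - (1 / \<beta> - (\<alpha> - 2) / t) *\<^sub>R x t + (1 / t + 1 / \<beta>) *\<^sub>R y t) = 0"
              using \<open>t0 \<le> t\<close> \<open>t0 > 0\<close> \<open>\<beta> > 0\<close>
              by (simp add: inner_simps y_def yd_def c_def g_def xdd_eq field_simps power2_eq_square)
          qed
          then show "\<exists>xd yd. (x has_vector_derivative xd) (at t within {t0..}) \<and>
            (y has_vector_derivative yd) (at t within {t0..}) \<and>
            xd + (\<beta> * \<delta> t) *\<^sub>R moreau_grad f (\<gamma> t) (x t) + ((\<alpha> - 1) / t - 1 / \<beta>) *\<^sub>R x t + (1 / \<beta>) *\<^sub>R y t = 0 \<and>
            yd - (1 / \<beta> - (\<alpha> - 2) / t) *\<^sub>R x t + (1 / t + 1 / \<beta>) *\<^sub>R y t = 0"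
            using x y eq1[OF t] unfolding G_def by blast
        qed
      qed
    qed
    then show "\<exists>y. first_order_solution f \<alpha> \<beta> \<delta> \<gamma> t0 x0 y0 x y"
      by blast
  }

  \<comment> \<open>From the system to the second-order equation\<close>
  {
    assume "\<exists>y. first_order_solution f \<alpha> \<beta> \<delta> \<gamma> t0 x0 y0 x y"
    then obtain y where ac: "loc_abs_cont_from t0 x" "loc_abs_cont_from t0 y"
      and ae: "AE t in lebesgue. t0 \<le> t \<longrightarrow> (\<exists>xd yd. (x has_vector_derivative xd) (at t within {t0..}) \<and>
          (y has_vector_derivative yd) (at t within {t0..}) \<and>
          xd + (\<beta> * \<delta> t) *\<^sub>R G t + ((\<alpha> - 1) / t - 1 / \<beta>) *\<^sub>R x t + (1 / \<beta>) *\<^sub>R y t = 0 \<and>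
          yd - (1 / \<beta> - (\<alpha> - 2) / t) *\<^sub>R x t + (1 / t + 1 / \<beta>) *\<^sub>R y t = 0)"
      and init: "x t0 = x0" "y t0 = y0"
      unfolding first_order_solution_def G_def by blast
    \<comment> \<open>\<open>h\<close> and \<open>k\<close> are the two equations solved for the
      derivatives of \<open>x\<close> and \<open>y\<close>. They are continuous, so the derivatives
      can be identified everywhere.\<close>
    define h where "h = (\<lambda>t. (- \<beta>) *\<^sub>R g t + (((1 - \<alpha>) / t) *\<^sub>R x t + ((1 / \<beta>) *\<^sub>R x t + (- 1 / \<beta>) *\<^sub>R y t)))"
    define k where "k = (\<lambda>t. (1 / \<beta>) *\<^sub>R x t + (((2 - \<alpha>) / t) *\<^sub>R x t + ((- 1 / t) *\<^sub>R y t + (- 1 / \<beta>) *\<^sub>R y t)))"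
    note x_cont = loc_abs_cont_from_continuous_on[OF ac(1)]
    note y_cont = loc_abs_cont_from_continuous_on[OF ac(2)]
    have g_cont: "continuous_on {t0..} g"
      unfolding g_def G_def
      by (intro continuous_on_scaleR continuous_on_moreau_grad_path f x_cont \<gamma>pos
          loc_lipschitz_from_continuous_on[OF \<delta>] loc_lipschitz_from_continuous_on[OF \<gamma>])
    have inv_cont: "continuous_on {t0..} (\<lambda>t. c / t)" for c :: real
      using loc_lipschitz_from_continuous_on[OF lip_inverse] .
    have h_cont: "continuous_on {t0..} h"
      unfolding h_def by (intro continuous_on_add continuous_on_scaleR continuous_on_const g_cont x_cont y_cont inv_cont)
    have k_cont: "continuous_on {t0..} k"
      unfolding k_def by (intro continuous_on_add continuous_on_scaleR continuous_on_const x_cont y_cont inv_cont)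
    have der: "AE t in lebesgue. t0 \<le> t \<longrightarrow> (x has_vector_derivative h t) (at t within {t0..}) \<and>
        (y has_vector_derivative k t) (at t within {t0..})"
      using ae
    proof eventually_elim
      case (elim t)
      show ?case
      proof
        assume t: "t0 \<le> t"
        with elim obtain xd yd where d: "(x has_vector_derivative xd) (at t within {t0..})"
            "(y has_vector_derivative yd) (at t within {t0..})"
          and eq: "xd + (\<beta> * \<delta> t) *\<^sub>R G t + ((\<alpha> - 1) / t - 1 / \<beta>) *\<^sub>R x t + (1 / \<beta>) *\<^sub>R y t = 0"
            "yd - (1 / \<beta> - (\<alpha> - 2) / t) *\<^sub>R x t + (1 / t + 1 / \<beta>) *\<^sub>R y t = 0"
          by blast
        have "h t - xd = 0"
        proof -
          have "h t - xd = - (xd + (\<beta> * \<delta> t) *\<^sub>R G t + ((\<alpha> - 1) / t - 1 / \<beta>) *\<^sub>R x t + (1 / \<beta>) *\<^sub>R y t)"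
            by (simp add: h_def g_def algebra_simps diff_divide_distrib)
          then show ?thesis
            using eq(1) by simp
        qed
        moreover have "k t - yd = 0"
        proof -
          have "k t - yd = - (yd - (1 / \<beta> - (\<alpha> - 2) / t) *\<^sub>R x t + (1 / t + 1 / \<beta>) *\<^sub>R y t)"
            by (simp add: k_def algebra_simps diff_divide_distrib)
          then show ?thesis
            using eq(2) by simp
        qed
        ultimately show "(x has_vector_derivative h t) (at t within {t0..}) \<and> (y has_vector_derivative k t) (at t within {t0..})"
          using d by simp
      qed
    qed
    have C1: "C1_from t0 x h" "C1_from t0 y k"
      using eventually_mono[OF der, of "\<lambda>t. t0 \<le> t \<longrightarrow> (x has_vector_derivative h t) (at t within {t0..})"]
        eventually_mono[OF der, of "\<lambda>t. t0 \<le> t \<longrightarrow> (y has_vector_derivative k t) (at t within {t0..})"]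
      by (simp_all add: abs_cont_ae_derivative_imp_C1_from ac h_cont k_cont)
    note x_lip = C1_from_imp_loc_lipschitz_from[OF C1(1)]
    note y_lip = C1_from_imp_loc_lipschitz_from[OF C1(2)]
    \<comment> \<open>With \<open>x\<close> and \<open>y\<close> now C1, every term of
      \<open>h\<close>, including \<open>g\<close>, is locally Lipschitz. This yields the absolute
      continuity required of the derivative of \<open>x\<close>.\<close>
    have h_lip: "loc_lipschitz_from t0 h"
      unfolding h_def by (intro lip_intros g_lip x_lip y_lip)
    \<comment> \<open>Since \<open>x\<close> and \<open>y\<close> are differentiable everywhere,
      \<open>h\<close> is differentiable wherever \<open>g\<close> is, and \<open>g\<close> is so
      almost everywhere.\<close>
    have eq: "AE t in lebesgue. t0 \<le> t \<longrightarrow> (\<exists>xdd gd. (h has_vector_derivative xdd) (at t within {t0..}) \<and>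
        (g has_vector_derivative gd) (at t within {t0..}) \<and>
        xdd + (\<alpha> / t) *\<^sub>R h t + \<beta> *\<^sub>R gd + ((1 + \<beta> / t) * \<delta> t) *\<^sub>R G t = 0)"
      using loc_lipschitz_from_differentiable_ae[OF g_lip[OF x_lip]]
    proof eventually_elim
      case (elim t)
      show ?case
      proof
        assume t: "t0 \<le> t"
        with elim obtain gd where gd: "(g has_vector_derivative gd) (at t within {t0..})"
          by blast
        have x: "(x has_vector_derivative h t) (at t within {t0..})"
          and y: "(y has_vector_derivative k t) (at t within {t0..})"
          using C1 \<open>t0 \<le> t\<close> by (auto simp: C1_from_def)
        define hd where "hd = (- \<beta>) *\<^sub>R gd + ((((1 - \<alpha>) / t) *\<^sub>R h t + (- ((1 - \<alpha>) / t\<^sup>2)) *\<^sub>R x t)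
          + ((1 / \<beta>) *\<^sub>R h t + (- 1 / \<beta>) *\<^sub>R k t))"
        have "(h has_vector_derivative hd) (at t within {t0..})"
          unfolding hd_def by (subst h_def) (intro vd_intros gd x y \<open>t0 \<le> t\<close>)
        \<comment> \<open>The term in \<open>gd\<close> inside \<open>hd\<close> cancels
          \<open>\<beta> *\<^sub>R gd\<close>; unfolding \<open>h\<close> and \<open>k\<close>
          leaves an identity in \<open>x t\<close>, \<open>y t\<close> and
          \<open>G t\<close>.\<close>
        moreover have "hd + (\<alpha> / t) *\<^sub>R h t + \<beta> *\<^sub>R gd + ((1 + \<beta> / t) * \<delta> t) *\<^sub>R G t = 0"
          by (rule inner_eq_zeroI) (use \<open>t0 \<le> t\<close> \<open>t0 > 0\<close> \<open>\<beta> > 0\<close> in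
            \<open>simp add: inner_simps hd_def h_def k_def g_def field_simps power2_eq_square\<close>)
        ultimately show "\<exists>xdd gd. (h has_vector_derivative xdd) (at t within {t0..}) \<and>
          (g has_vector_derivative gd) (at t within {t0..}) \<and>
          xdd + (\<alpha> / t) *\<^sub>R h t + \<beta> *\<^sub>R gd + ((1 + \<beta> / t) * \<delta> t) *\<^sub>R G t = 0"
          using gd by blast
      qed
    qed
    have "h t0 = v0"
      by (simp add: h_def g_def G_def init v0 algebra_simps diff_divide_distrib)
    then show "second_order_solution f \<alpha> \<beta> \<delta> \<gamma> t0 x0 v0 x"
      unfolding second_order_solution_def
      using C1(1) loc_lipschitz_from_imp_loc_abs_cont_from[OF h_lip] eq init(1)
      unfolding g_def G_def by blast
  }
qed

end
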